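(* Consider the reduced system $\dot x = G(x)$ on the open positive orthant $\mathbb{R}_{+}^4=(0,\infty)^4$, with state $x=(\mu_{34},s,\mu_{200},z)$, as defined in the context, and assume the parameter inequalities stated there. Assume in addition that the set of equilibria of this system in $\mathbb{R}_+^4$ is totally disconnected. Let $W^c\subseteq \mathbb{R}_+^4$ be the set of initial points whose forward orbit has compact closure contained in $\mathbb{R}_+^4$. Then for Lebesgue-almost every initial point $x_0\in W^c$, the forward trajectory starting at $x_0$ converges to an equilibrium.
   Context: All of the following are positive real parameters: $A_s, A_z, E_{34}, E_{200}, E_S, E_Z, \beta_{34}, \beta_{-34}, \beta_{200}, \beta_{-200}, \gamma_s, \gamma_z, c_s, c_{-s}, c_z, c_{-z}, \beta_s, \beta_{s1}, \beta_{s2}, \beta_z, \beta_{z1}, \beta_{z2}, k_s, k_{s1}, k_{s2}, k_{-s}, k_z, k_{z1}, k_{z2}, k_{-z}, \delta_z$. They satisfy $\beta_s<\beta_{s1}<\beta_{s2}$, $\beta_z<\beta_{z1}<\beta_{z2}$, $k_s>k_{s1}>k_{s2}$ and $k_z>k_{z1}>k_{z2}$. For $\rho\in\{s,z\}$ define $e_{\rho1}=\beta_{\rho1}\beta_{\rho2}+(\beta_{\rho1}+\beta_{\rho2})c_{-\rho}+c_{-\rho}^2$, $e_{\rho2}=c_\rho(\beta_{\rho2}+c_{-\rho})$, $e_{\rho3}=\beta_\rho\beta_{\rho2}+\beta_{\rho1}\beta_{\rho2}+\beta_{\rho1}c_{-\rho}$, $\Delta_\rho(\mu)=\beta_{\rho2}c_\rho^2\mu^2+e_{\rho3}c_\rho\mu+e_{\rho1}\beta_\rho$,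 and $N_\rho(\mu)=\dfrac{k_\rho(\beta_{\rho2}c_\rho\mu+e_{\rho1})+k_{\rho1}e_{\rho2}\mu+k_{\rho2}c_\rho^2\mu^2}{\Delta_\rho(\mu)}$ for $\mu\ge 0$. The reduced system $\dot x=G(x)$, $x=(\mu_{34},s,\mu_{200},z)$, is $\dot\mu_{34}=\dfrac{\beta_{34}E_{34}A_sA_z}{(s^2+A_s)(z^2+A_z)}-\beta_{-34}\mu_{34}$, $\dot s=\dfrac{\gamma_sE_SA_s}{s^2+A_s}N_s(\mu_{34})-k_{-s}s$, $\dot\mu_{200}=\dfrac{\beta_{200}E_{200}A_sA_z}{(s^2+A_s)(z^2+A_z)}-\beta_{-200}\mu_{200}$, $\dot z=\delta_z+\dfrac{\gamma_zE_Zs^2z^2}{(s^2+A_s)(z^2+A_z)}N_z(\mu_{200})-k_{-z}z$. *)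

theory Defs
  imports "HOL-Analysis.Analysis"
begin

record params =
  A_s :: real  A_z :: real  E34 :: real  E200 :: real  E_S :: real  E_Z :: real
  b34 :: real  bm34 :: real  b200 :: real  bm200 :: real
  gam_s :: real  gam_z :: real
  c_s :: real  cm_s :: real  c_z :: real  cm_z :: real
  bt_s :: real  bt_s1 :: real  bt_s2 :: real
  bt_z :: real  bt_z1 :: real  bt_z2 :: real
  k_s :: real  k_s1 :: real  k_s2 :: real  km_s :: real
  k_z :: real  k_z1 :: real  k_z2 :: real  km_z :: real
  delta_z :: real

definition admissible :: "params \<Rightarrow> bool" where
  "admissible p \<longleftrightarrow>
     0 < A_s p \<and> 0 < A_z p \<and> 0 < E34 p \<and> 0 < E200 p \<and> 0 < E_S p \<and> 0 < E_Z p \<and>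
     0 < b34 p \<and> 0 < bm34 p \<and> 0 < b200 p \<and> 0 < bm200 p \<and>
     0 < gam_s p \<and> 0 < gam_z p \<and>
     0 < c_s p \<and> 0 < cm_s p \<and> 0 < c_z p \<and> 0 < cm_z p \<and>
     0 < bt_s p \<and> 0 < bt_s1 p \<and> 0 < bt_s2 p \<and>
     0 < bt_z p \<and> 0 < bt_z1 p \<and> 0 < bt_z2 p \<and>
     0 < k_s p \<and> 0 < k_s1 p \<and> 0 < k_s2 p \<and> 0 < km_s p \<and>
     0 < k_z p \<and> 0 < k_z1 p \<and> 0 < k_z2 p \<and> 0 < km_z p \<and>
     0 < delta_z p \<and>
     bt_s p < bt_s1 p \<and> bt_s1 p < bt_s2 p \<and>
     bt_z p < bt_z1 p \<and> bt_z1 p < bt_z2 p \<and>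
     k_s p > k_s1 p \<and> k_s1 p > k_s2 p \<and>
     k_z p > k_z1 p \<and> k_z1 p > k_z2 p"

definition Nfun :: "real \<Rightarrow> real \<Rightarrow> real \<Rightarrow> real \<Rightarrow> real \<Rightarrow> real \<Rightarrow> real \<Rightarrow> real \<Rightarrow> real \<Rightarrow> real" where
  "Nfun k k1 k2 b b1 b2 c cm \<mu> =
     (let e1 = b1 * b2 + (b1 + b2) * cm + cm^2;
          e2 = c * (b2 + cm);
          e3 = b * b2 + b1 * b2 + b1 * cm;
          D = b2 * c^2 * \<mu>^2 + e3 * c * \<mu> + e1 * b
      in (k * (b2 * c * \<mu> + e1) + k1 * e2 * \<mu> + k2 * c^2 * \<mu>^2) / D)"

definition N_s :: "params \<Rightarrow> real \<Rightarrow> real" where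
  "N_s p = Nfun (k_s p) (k_s1 p) (k_s2 p) (bt_s p) (bt_s1 p) (bt_s2 p) (c_s p) (cm_s p)"

definition N_z :: "params \<Rightarrow> real \<Rightarrow> real" where
  "N_z p = Nfun (k_z p) (k_z1 p) (k_z2 p) (bt_z p) (bt_z1 p) (bt_z2 p) (c_z p) (cm_z p)"

type_synonym state = "real \<times> real \<times> real \<times> real"

definition G :: "params \<Rightarrow> state \<Rightarrow> state" where
  "G p x = (case x of (m34, s, m200, z) \<Rightarrow>
     (b34 p * E34 p * A_s p * A_z p / ((s^2 + A_s p) * (z^2 + A_z p)) - bm34 p * m34,
      gam_s p * E_S p * A_s p / (s^2 + A_s p) * N_s p m34 - km_s p * s,
      b200 p * E200 p * A_s p * A_z p / ((s^2 + A_s p) * (z^2 + A_z p)) - bm200 p * m200,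
      delta_z p + gam_z p * E_Z p * s^2 * z^2 / ((s^2 + A_s p) * (z^2 + A_z p)) * N_z p m200
        - km_z p * z))"

definition orthant :: "state set" where
  "orthant = {(a, b, c, d). 0 < a \<and> 0 < b \<and> 0 < c \<and> 0 < d}"

definition fwd_solution :: "params \<Rightarrow> state \<Rightarrow> (real \<Rightarrow> state) \<Rightarrow> bool" where
  "fwd_solution p x0 x \<longleftrightarrow> x 0 = x0 \<and> (\<forall>t\<ge>0. x t \<in> orthant) \<and>
     (\<forall>t\<ge>0. (x has_vector_derivative G p (x t)) (at t within {0..}))"

definition equilibria :: "params \<Rightarrow> state set" where
  "equilibria p = {e \<in> orthant. G p e = 0}"

definition totally_disconnected :: "'a::topological_space set \<Rightarrow> bool" where
  "totally_disconnected S \<longleftrightarrow> (\<forall>T. T \<subseteq> S \<and> connected T \<longrightarrow> (\<exists>a. T \<subseteq> {a}))"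

definition Wc :: "params \<Rightarrow> state set" where
  "Wc p = {x0 \<in> orthant. \<exists>x. fwd_solution p x0 x \<and>
              compact (closure (x ` {0..})) \<and> closure (x ` {0..}) \<subseteq> orthant}"

end

theory Submission
  imports Defs
begin

text \<open>
  In the order that reverses the two microRNA coordinates, the off-diagonal entries of the Jacobian of \<open>G\<close>
  are nonnegative (because the \<open>N\<^sub>\<rho>\<close> are decreasing) and its interaction graph is strongly connected, so the
  flow is strongly monotone. Hirsch's argument then applies. A limit set contains no two ordered points, and
  if \<open>x < y\<close> and \<open>\<omega>(x)\<close> contains a non-equilibrium, then every point of \<open>\<omega>(x)\<close> lies below every point of \<open>\<omega>(y)\<close>.
  Since limit sets are connected and the equilibria totally disconnected, a non-convergent orbit has a
  non-equilibrium in its limit set, hence a limit set of positive extent in some coordinate. Along a line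
  parallel to the \<open>\<mu>\<^sub>3\<^sub>4\<close>-axis the points are totally ordered, so the coordinate ranges of the limit sets of
  non-convergent points do not overlap and only countably many such points exist. The set of non-convergent
  points is Borel, so it is null by Fubini's theorem.
\<close>

section \<open>Limit sets of strongly order preserving semiflows\<close>

text \<open>Requiring \<open>real n \<le> ts n\<close> instead of mere divergence of \<open>ts\<close> is no restriction, and the condition
  passes to subsequences.\<close>

definition omega_limit :: "(real \<Rightarrow> 'a \<Rightarrow> 'a::metric_space) \<Rightarrow> 'a \<Rightarrow> 'a set" where
  "omega_limit flow x =
     {p. \<exists>ts. (\<forall>n. real n \<le> ts n) \<and> (\<lambda>n. flow (ts n) x) \<longlonglongrightarrow> p}"

lemma compact_unique_limit:
  fixes a :: "nat \<Rightarrow> 'a::metric_space"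
  assumes "compact X" "\<And>n. a n \<in> X"
    and uniq: "\<And>r q. strict_mono r \<Longrightarrow> (a \<circ> r) \<longlonglongrightarrow> q \<Longrightarrow> q = p"
  shows "a \<longlonglongrightarrow> p"
proof (rule ccontr)
  assume "\<not> a \<longlonglongrightarrow> p"
  then obtain e where e: "e > 0" "\<And>N. \<exists>n\<ge>N. dist (a n) p \<ge> e"
    by (auto simp: lim_sequentially not_less)
  define S where "S = {n. dist (a n) p \<ge> e}"
  have "infinite S"
    using e(2) by (auto simp: infinite_nat_iff_unbounded_le S_def)
  then obtain r1 :: "nat \<Rightarrow> nat" where r1: "strict_mono r1" "\<And>n. r1 n \<in> S"
    using infinite_enumerate by blast
  obtain q r2 where r2: "strict_mono r2" "((a \<circ> r1) \<circ> r2) \<longlonglongrightarrow> q"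
    using \<open>compact X\<close> assms(2) unfolding compact_def by (metis comp_apply)
  have "strict_mono (r1 \<circ> r2)"
    using r1 r2 by (simp add: strict_mono_o)
  then have "q = p"
    using uniq r2(2) by (simp add: comp_assoc)
  then obtain n where "dist (a (r1 (r2 n))) p < e"
    using r2(2) e(1) by (fastforce simp: lim_sequentially)
  then show False
    using r1(2) by (auto simp: S_def not_less[symmetric])
qed

lemma omega_limit_iff:
  "p \<in> omega_limit flow x \<longleftrightarrow> (\<forall>e>0. \<forall>T. \<exists>t\<ge>T. dist (flow t x) p < e)"
proof
  assume "p \<in> omega_limit flow x"
  then obtain ts where ts: "\<And>n. real n \<le> ts n" "(\<lambda>n. flow (ts n) x) \<longlonglongrightarrow> p"
    by (auto simp: omega_limit_def)
  show "\<forall>e>0. \<forall>T. \<exists>t\<ge>T. dist (flow t x) p < e"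
  proof (intro allI impI)
    fix e T :: real assume "e > 0"
    then obtain N where N: "\<And>n. n \<ge> N \<Longrightarrow> dist (flow (ts n) x) p < e"
      using ts(2) by (auto simp: lim_sequentially)
    define n where "n = max N (nat \<lceil>T\<rceil>)"
    have "T \<le> ts n"
      using ts(1)[of n] unfolding n_def by linarith
    then show "\<exists>t\<ge>T. dist (flow t x) p < e"
      using N[of n] by (auto simp: n_def)
  qed
next
  assume h: "\<forall>e>0. \<forall>T. \<exists>t\<ge>T. dist (flow t x) p < e"
  have "\<exists>t\<ge>real n. dist (flow t x) p < inverse (real (Suc n))" for n
    using h by simp
  then obtain ts where ts: "\<And>n. ts n \<ge> real n"
      "\<And>n. dist (flow (ts n) x) p < inverse (real (Suc n))"
    by metis
  have "(\<lambda>n. dist (flow (ts n) x) p) \<longlonglongrightarrow> 0"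
    by (rule tendsto_sandwich[OF _ _ tendsto_const LIMSEQ_inverse_real_of_nat])
       (auto intro!: always_eventually less_imp_le[OF ts(2)] simp del: of_nat_Suc)
  then show "p \<in> omega_limit flow x"
    unfolding omega_limit_def using ts(1) by (auto simp: tendsto_dist_iff[of _ p])
qed

lemma closed_omega_limit: "closed (omega_limit flow x)"
  unfolding closed_sequential_limits
proof -
  show "\<forall>xa l. (\<forall>n. xa n \<in> omega_limit flow x) \<and> xa \<longlonglongrightarrow> l \<longrightarrow> l \<in> omega_limit flow x"
  proof (intro allI impI, elim conjE)
    fix xa l
    assume xa: "\<forall>n. xa n \<in> omega_limit flow x" "xa \<longlonglongrightarrow> l"
    show "l \<in> omega_limit flow x"
      unfolding omega_limit_iff
    proof (intro allI impI)
      fix e T :: real assume "e > 0"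
      then obtain n where n: "dist (xa n) l < e/2"
        using xa(2) by (metis half_gt_zero lim_sequentially order_refl)
      obtain t where "t \<ge> T" "dist (flow t x) (xa n) < e/2"
        using xa(1) \<open>e > 0\<close> unfolding omega_limit_iff by (metis half_gt_zero)
      moreover from this have "dist (flow t x) l < e"
        using n dist_triangle[of "flow t x" l "xa n"] by linarith
      ultimately show "\<exists>t\<ge>T. dist (flow t x) l < e" by blast
    qed
  qed
qed

locale sop_semiflow =
  fixes X :: "'a::euclidean_space set"
    and flow :: "real \<Rightarrow> 'a \<Rightarrow> 'a"
    and le :: "'a \<Rightarrow> 'a \<Rightarrow> bool"
  assumes compact_X: "compact X"
    and le_refl: "le x x"
    and le_trans: "le x y \<Longrightarrow> le y z \<Longrightarrow> le x z"
    and le_antisym: "le x y \<Longrightarrow> le y x \<Longrightarrow> x = y"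
    and le_closed: "xs \<longlonglongrightarrow> x \<Longrightarrow> ys \<longlonglongrightarrow> y \<Longrightarrow> (\<And>n. le (xs n) (ys n)) \<Longrightarrow> le x y"
    and flow_in: "x \<in> X \<Longrightarrow> 0 \<le> t \<Longrightarrow> flow t x \<in> X"
    and flow_0: "x \<in> X \<Longrightarrow> flow 0 x = x"
    and flow_add: "x \<in> X \<Longrightarrow> 0 \<le> s \<Longrightarrow> 0 \<le> t \<Longrightarrow> flow (s + t) x = flow s (flow t x)"
    and flow_cont: "(\<And>n. 0 \<le> ts n) \<Longrightarrow> (\<And>n. xs n \<in> X) \<Longrightarrow> x \<in> X \<Longrightarrow> ts \<longlonglongrightarrow> t \<Longrightarrow> xs \<longlonglongrightarrow> x
          \<Longrightarrow> (\<lambda>n. flow (ts n) (xs n)) \<longlonglongrightarrow> flow t x"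
    and sop: "x \<in> X \<Longrightarrow> y \<in> X \<Longrightarrow> le x y \<Longrightarrow> x \<noteq> y \<Longrightarrow> 0 < t \<Longrightarrow>
          \<exists>e>0. \<forall>x'\<in>X. \<forall>y'\<in>X. dist x' x < e \<longrightarrow> dist y' y < e \<longrightarrow> le (flow t x') (flow t y')"
begin

abbreviation \<omega> :: "'a \<Rightarrow> 'a set" where "\<omega> \<equiv> omega_limit flow"

lemma dual: "sop_semiflow X flow (\<lambda>x y. le y x)"
proof
  fix xs ys x y assume "xs \<longlonglongrightarrow> x" "ys \<longlonglongrightarrow> y" "\<And>n. le (ys n) (xs n)"
  then show "le y x" using le_closed by blast
next
  fix x y :: 'a and t :: real
  assume "x \<in> X" "y \<in> X" "le y x" "x \<noteq> y" "0 < t"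
  then show "\<exists>e>0. \<forall>x'\<in>X. \<forall>y'\<in>X. dist x' x < e \<longrightarrow> dist y' y < e \<longrightarrow> le (flow t y') (flow t x')"
    using sop[of y x t] by metis
qed (use compact_X le_refl le_trans le_antisym flow_in flow_0 flow_add flow_cont in \<open>blast+\<close>)

lemma flow_mono:
  assumes "x \<in> X" "y \<in> X" "le x y" "0 \<le> t"
  shows "le (flow t x) (flow t y)"
proof (cases "x = y \<or> t = 0")
  case True
  then show ?thesis using assms flow_0 le_refl by auto
next
  case False
  then show ?thesis using sop[of x y t] assms by (metis dist_self less_le)
qed

lemma flow_cont_time:
  assumes "x \<in> X" "0 \<le> t" "e > 0"
  shows "\<exists>d>0. \<forall>r\<in>{0..d}. dist (flow (t + r) x) (flow t x) < e"
proof (rule ccontr)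
  assume "\<not> ?thesis"
  then have "\<exists>r\<in>{0..inverse (real (Suc n))}. dist (flow (t + r) x) (flow t x) \<ge> e" for n
    by (metis inverse_positive_iff_positive not_less of_nat_0_less_iff zero_less_Suc)
  then obtain r where r: "\<And>n. r n \<in> {0..inverse (real (Suc n))}"
      "\<And>n. dist (flow (t + r n) x) (flow t x) \<ge> e"
    by metis
  have "r \<longlonglongrightarrow> 0"
    by (rule tendsto_sandwich[OF _ _ tendsto_const LIMSEQ_inverse_real_of_nat])
       (use r(1) in \<open>auto intro!: always_eventually\<close>)
  then have "(\<lambda>n. t + r n) \<longlonglongrightarrow> t"
    using tendsto_add[OF tendsto_const[of t]] by fastforce
  moreover have "\<And>n. 0 \<le> t + r n"
    using r(1) assms(2) by (simp add: add_nonneg_nonneg)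
  ultimately have "(\<lambda>n. flow (t + r n) x) \<longlonglongrightarrow> flow t x"
    using flow_cont[of "\<lambda>n. t + r n" "\<lambda>_. x" x t] assms by simp
  then obtain n where "dist (flow (t + r n) x) (flow t x) < e"
    using assms(3) by (metis lim_sequentially order_refl)
  then show False using r(2)[of n] by simp
qed

lemma omega_sub: "x \<in> X \<Longrightarrow> \<omega> x \<subseteq> X"
proof
  fix p assume "x \<in> X" "p \<in> \<omega> x"
  then obtain ts where ts: "\<And>n. real n \<le> ts n" "(\<lambda>n. flow (ts n) x) \<longlonglongrightarrow> p"
    by (auto simp: omega_limit_def)
  have "flow (ts n) x \<in> X" for n
    using ts(1)[of n] flow_in[OF \<open>x \<in> X\<close>] by (meson of_nat_0_le_iff order_trans)
  then show "p \<in> X"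
    by (rule closed_sequentially[OF compact_imp_closed[OF compact_X] _ ts(2)])
qed

lemma compact_omega: "x \<in> X \<Longrightarrow> compact (\<omega> x)"
  using compact_Int_closed[OF compact_X closed_omega_limit[of flow x]] omega_sub[of x]
  by (simp add: inf.absorb2)

lemma subseq_limit:
  assumes "x \<in> X" "\<And>n. real n \<le> ts n"
  obtains r p where "strict_mono r" "p \<in> \<omega> x" "(\<lambda>n. flow (ts (r n)) x) \<longlonglongrightarrow> p"
    "\<And>n. real n \<le> ts (r n)"
proof -
  have "flow (ts n) x \<in> X" for n
    using assms(2)[of n] flow_in[OF \<open>x \<in> X\<close>] by (meson of_nat_0_le_iff order_trans)
  then obtain r p where r: "strict_mono r" "((\<lambda>n. flow (ts n) x) \<circ> r) \<longlonglongrightarrow> p"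
    using compact_X unfolding compact_def by metis
  have "real n \<le> ts (r n)" for n
    using assms(2)[of "r n"] seq_suble[OF r(1), of n] by linarith
  moreover from this have "p \<in> \<omega> x"
    using r(2) by (auto simp: omega_limit_def comp_def intro!: exI[of _ "\<lambda>n. ts (r n)"])
  ultimately show ?thesis using that r by (auto simp: comp_def)
qed

lemma omega_nonempty: "x \<in> X \<Longrightarrow> \<omega> x \<noteq> {}"
  by (rule subseq_limit[of x real]) auto

lemma omega_flow:
  assumes "x \<in> X" "p \<in> \<omega> x" "0 \<le> s"
  shows "flow s p \<in> \<omega> x"
proof -
  obtain ts where ts: "\<And>n. real n \<le> ts n" "(\<lambda>n. flow (ts n) x) \<longlonglongrightarrow> p"
    using assms by (auto simp: omega_limit_def)
  have pos: "0 \<le> ts n" for n using ts(1)[of n] by linarith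
  have "(\<lambda>n. flow s (flow (ts n) x)) \<longlonglongrightarrow> flow s p"
    using flow_cont[of "\<lambda>_. s" "\<lambda>n. flow (ts n) x" p s] assms pos ts omega_sub flow_in by auto
  then have "(\<lambda>n. flow (s + ts n) x) \<longlonglongrightarrow> flow s p"
    using flow_add assms pos by simp
  moreover have "real n \<le> s + ts n" for n using ts(1)[of n] assms by linarith
  ultimately show ?thesis
    by (auto simp: omega_limit_def intro!: exI[of _ "\<lambda>n. s + ts n"])
qed

lemma omega_shift_times:
  assumes "p \<in> \<omega> x"
  obtains ts where "\<And>n. real n \<le> ts n" "(\<lambda>n. flow (s + ts n) x) \<longlonglongrightarrow> p"
proof -
  obtain ts where ts: "\<And>n. real n \<le> ts n" "(\<lambda>n. flow (ts n) x) \<longlonglongrightarrow> p"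
    using assms by (auto simp: omega_limit_def)
  define k where "k = nat \<lceil>s\<rceil>"
  have "(\<lambda>n. flow (s + (ts (n + k) - s)) x) \<longlonglongrightarrow> p"
    using LIMSEQ_ignore_initial_segment[OF ts(2), of k] by simp
  moreover have "real n \<le> ts (n + k) - s" for n
    using ts(1)[of "n + k"] unfolding k_def by linarith
  ultimately show ?thesis using that[of "\<lambda>n. ts (n + k) - s"] by blast
qed

lemma omega_preimage:
  assumes "x \<in> X" "p \<in> \<omega> x" "0 \<le> s"
  obtains q where "q \<in> \<omega> x" "flow s q = p"
proof -
  obtain ts where ts: "\<And>n. real n \<le> ts n" "(\<lambda>n. flow (s + ts n) x) \<longlonglongrightarrow> p"
    using omega_shift_times[OF assms(2)] by blast
  obtain r q where r: "strict_mono r" "q \<in> \<omega> x" "(\<lambda>n. flow (ts (r n)) x) \<longlonglongrightarrow> q"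
    "\<And>n. real n \<le> ts (r n)"
    using subseq_limit[OF assms(1) ts(1)] by blast
  have pos: "0 \<le> ts (r n)" for n using r(4)[of n] by linarith
  have "(\<lambda>n. flow s (flow (ts (r n)) x)) \<longlonglongrightarrow> flow s q"
    using flow_cont[of "\<lambda>_. s" "\<lambda>n. flow (ts (r n)) x" q s] assms pos r omega_sub flow_in by auto
  then have "(\<lambda>n. flow (s + ts (r n)) x) \<longlonglongrightarrow> flow s q"
    using flow_add assms pos by simp
  moreover have "(\<lambda>n. flow (s + ts (r n)) x) \<longlonglongrightarrow> p"
    using LIMSEQ_subseq_LIMSEQ[OF ts(2) r(1)] by (simp add: comp_def)
  ultimately show ?thesis using that[of q] r(2) LIMSEQ_unique by blast
qed

lemma omega_of_shift:
  assumes "x \<in> X" "0 \<le> s"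
  shows "\<omega> x \<subseteq> \<omega> (flow s x)"
proof
  fix p assume "p \<in> \<omega> x"
  then obtain ts where ts: "\<And>n. real n \<le> ts n" "(\<lambda>n. flow (s + ts n) x) \<longlonglongrightarrow> p"
    using omega_shift_times by blast
  have "flow (s + ts n) x = flow (ts n) (flow s x)" for n
    using flow_add[OF assms(1), of "ts n" s] ts(1)[of n] assms(2) by (simp add: add.commute)
  then show "p \<in> \<omega> (flow s x)"
    using ts by (auto simp: omega_limit_def)
qed

lemma omega_trans:
  assumes "x \<in> X" "y \<in> \<omega> x"
  shows "\<omega> y \<subseteq> \<omega> x"
proof
  fix z assume "z \<in> \<omega> y"
  then obtain ts where ts: "\<And>n. real n \<le> ts n" "(\<lambda>n. flow (ts n) y) \<longlonglongrightarrow> z"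
    by (auto simp: omega_limit_def)
  have "flow (ts n) y \<in> \<omega> x" for n
    using omega_flow assms ts(1)[of n] by (meson of_nat_0_le_iff order_trans)
  then show "z \<in> \<omega> x"
    by (rule closed_sequentially[OF closed_omega_limit _ ts(2)])
qed

lemma fixed_if_locally_fixed:
  assumes "p \<in> X" "d > 0" "\<And>r. 0 \<le> r \<Longrightarrow> r \<le> d \<Longrightarrow> flow r p = p" "0 \<le> t"
  shows "flow t p = p"
proof -
  obtain n :: nat where n: "t / d < real n" using reals_Archimedean2 by blast
  have n0: "0 < real n" using n assms by (meson divide_nonneg_pos le_less_trans)
  define r where "r = t / real n"
  have r: "0 \<le> r" "r \<le> d"
    using n n0 assms by (auto simp: r_def field_simps)
  have "flow (real k * r) p = p" for k
  proof (induction k)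
    case 0 then show ?case using flow_0 assms by simp
  next
    case (Suc k)
    have "flow (real (Suc k) * r) p = flow (r + real k * r) p"
      by (simp add: algebra_simps)
    also have "\<dots> = flow r (flow (real k * r) p)"
      using flow_add[OF assms(1)] r by simp
    finally show ?case using Suc assms(3) r by simp
  qed
  from this[of n] show ?thesis using n0 by (simp add: r_def)
qed

lemma monotone_times_limit:
  assumes x: "x \<in> X" and T: "1 \<le> T" and "le x (flow T x)"
  obtains p where "p \<in> \<omega> x" "\<And>q. q \<in> \<omega> x \<Longrightarrow> \<exists>s\<ge>0. q = flow s p" "flow T p = p"
proof -
  define a where "a n = flow (real n * T) x" for n
  have aX: "a n \<in> X" for n using flow_in x T by (simp add: a_def)
  have aSuc: "a (Suc n) = flow T (a n)" for n
    using flow_add[OF x, of T "real n * T"] T by (simp add: a_def algebra_simps)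
  have a1: "a (Suc n) = flow (real n * T) (flow T x)" for n
    using flow_add[OF x, of "real n * T" T] T by (simp add: a_def algebra_simps)
  have step: "le (a n) (a (Suc n))" for n
    unfolding a1 using assms flow_in flow_mono[of x "flow T x" "real n * T"] by (simp add: a_def)
  have am: "le (a m) (a n)" if "m \<le> n" for m n
    using that by (induction rule: dec_induct) (auto intro: le_refl le_trans step)
  have up: "le (a m) q" if r: "strict_mono r" "(a \<circ> r) \<longlonglongrightarrow> q" for m r q
  proof -
    have "le (a m) ((a \<circ> r) (n + m))" for n
      using am seq_suble[OF r(1), of "n + m"] by (simp add: order_trans[of m "n + m"])
    then show ?thesis
      using le_closed[OF tendsto_const LIMSEQ_ignore_initial_segment[OF r(2), of m]] by blast
  qed
  obtain p r where p: "p \<in> X" "strict_mono r" "(a \<circ> r) \<longlonglongrightarrow> p"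
    using compact_X aX unfolding compact_def by metis
  have lim: "a \<longlonglongrightarrow> p"
  proof (rule compact_unique_limit[OF compact_X aX])
    fix r' q assume q: "strict_mono r'" "(a \<circ> r') \<longlonglongrightarrow> q"
    have "le p q" using le_closed[OF p(3) tendsto_const[of q]] up[OF q] by simp
    moreover have "le q p" using le_closed[OF q(2) tendsto_const[of p]] up[OF p(2,3)] by simp
    ultimately show "q = p" using le_antisym by blast
  qed
  have "p \<in> \<omega> x"
    using lim T unfolding a_def omega_limit_def
    by (auto intro!: exI[of _ "\<lambda>n. real n * T"] simp: mult_le_cancel_left1)
  moreover have "flow T p = p"
  proof -
    have "(\<lambda>n. flow T (a n)) \<longlonglongrightarrow> flow T p"
      using flow_cont[of "\<lambda>_. T" a p T] T aX p(1) lim by simp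
    moreover have "(\<lambda>n. flow T (a n)) \<longlonglongrightarrow> p"
      using LIMSEQ_Suc[OF lim] aSuc by simp
    ultimately show ?thesis using LIMSEQ_unique by blast
  qed
  moreover have "\<exists>s\<ge>0. q = flow s p" if "q \<in> \<omega> x" for q
  proof -
    obtain ts where ts: "\<And>n. real n \<le> ts n" "(\<lambda>n. flow (ts n) x) \<longlonglongrightarrow> q"
      using \<open>q \<in> \<omega> x\<close> by (auto simp: omega_limit_def)
    have pos: "0 \<le> ts n" for n using ts(1)[of n] by linarith
    define N where "N n = nat \<lfloor>ts n / T\<rfloor>" for n
    define s where "s n = ts n - real (N n) * T" for n
    have N: "real (N n) \<le> ts n / T" "ts n / T < real (N n) + 1" for n
    proof -
      have "0 \<le> ts n / T" using pos[of n] T by simp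
      then have "real (N n) = of_int \<lfloor>ts n / T\<rfloor>" by (simp add: N_def)
      then show "real (N n) \<le> ts n / T" "ts n / T < real (N n) + 1" by linarith+
    qed
    have s: "s n \<in> {0..T}" for n
      using N[of n] T by (auto simp: s_def field_simps)
    obtain s0 r where r: "s0 \<in> {0..T}" "strict_mono r" "(s \<circ> r) \<longlonglongrightarrow> s0"
      using compact_Icc[of 0 T] s unfolding compact_def by metis
    have "filterlim (\<lambda>n. real (N n)) at_top sequentially"
    proof (rule filterlim_at_top_mono)
      show "filterlim (\<lambda>n. real n / T - 1) at_top sequentially"
        using T by real_asymp
      show "\<forall>\<^sub>F n in sequentially. real n / T - 1 \<le> real (N n)"
      proof (rule always_eventually, rule allI)
        fix n
        have "real n / T \<le> ts n / T" using ts(1)[of n] T by (simp add: divide_right_mono)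
        then show "real n / T - 1 \<le> real (N n)" using N(2)[of n] by linarith
      qed
    qed
    then have "filterlim N at_top sequentially"
      by (simp add: filterlim_sequentially_iff_filterlim_real)
    then have "filterlim (N \<circ> r) sequentially sequentially"
      using filterlim_subseq[OF r(2)] by (simp add: filterlim_compose comp_def)
    then have "(\<lambda>n. a (N (r n))) \<longlonglongrightarrow> p"
      using filterlim_compose[OF lim] by (simp add: comp_def)
    then have "(\<lambda>n. flow (s (r n)) (a (N (r n)))) \<longlonglongrightarrow> flow s0 p"
      using flow_cont[of "\<lambda>n. s (r n)" "\<lambda>n. a (N (r n))" p s0] aX p(1) s r(3)
      by (simp add: comp_def)
    moreover have "flow (s n) (a (N n)) = flow (ts n) x" for n
      using flow_add[OF x, of "s n" "real (N n) * T"] s[of n] T by (simp add: a_def s_def)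
    ultimately have "(\<lambda>n. flow (ts (r n)) x) \<longlonglongrightarrow> flow s0 p" by simp
    moreover have "(\<lambda>n. flow (ts (r n)) x) \<longlonglongrightarrow> q"
      using LIMSEQ_subseq_LIMSEQ[OF ts(2) r(2)] by (simp add: comp_def)
    ultimately show ?thesis using LIMSEQ_unique r(1) by (metis atLeastAtMost_iff)
  qed
  ultimately show ?thesis using that by blast
qed

lemma monotone_times_periodic:
  assumes x: "x \<in> X" and T: "1 \<le> T" and "le x (flow T x)" and "q \<in> \<omega> x"
  shows "flow T q = q"
proof -
  obtain p where p: "p \<in> \<omega> x" "\<And>q. q \<in> \<omega> x \<Longrightarrow> \<exists>s\<ge>0. q = flow s p" "flow T p = p"
    using monotone_times_limit[OF assms(1-3)] by blast
  obtain s where s: "s \<ge> 0" "q = flow s p" using p(2) assms(4) by blast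
  have "p \<in> X" using p(1) omega_sub x by blast
  then have "flow T q = flow s (flow T p)"
    using flow_add[of p T s] flow_add[of p s T] s T by (simp add: add.commute)
  then show ?thesis using p(3) s(2) by simp
qed

lemma omega_unordered:
  assumes x: "x \<in> X" and a: "a \<in> \<omega> x" and b: "b \<in> \<omega> x" and "le a b"
  shows "a = b"
proof (rule ccontr)
  assume "a \<noteq> b"
  have abX: "a \<in> X" "b \<in> X" using a b omega_sub x by blast+
  obtain e where e: "e > 0"
    "\<And>x' y'. x' \<in> X \<Longrightarrow> y' \<in> X \<Longrightarrow> dist x' a < e \<Longrightarrow> dist y' b < e \<Longrightarrow> le (flow 1 x') (flow 1 y')"
    using sop[OF abX \<open>le a b\<close> \<open>a \<noteq> b\<close>, of 1] by auto
  obtain t1 where t1: "t1 \<ge> 0" "dist (flow t1 x) a < e"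
    using a e(1) unfolding omega_limit_iff by blast
  obtain t2 where t2: "t2 \<ge> t1 + 1" "dist (flow t2 x) b < e / 2"
    using b half_gt_zero[OF e(1)] unfolding omega_limit_iff by blast
  obtain d where d: "d > 0" "\<And>r. 0 \<le> r \<Longrightarrow> r \<le> d \<Longrightarrow> dist (flow (t2 + r) x) (flow t2 x) < e / 2"
    using flow_cont_time[OF x, of t2 "e/2"] t1 t2 e(1) by auto
  define x' where "x' = flow (1 + t1) x"
  define T where "T = t2 - t1"
  have x': "x' \<in> X" using flow_in x t1 by (simp add: x'_def)
  have T: "1 \<le> T" using t2 by (simp add: T_def)
  have le: "le x' (flow (T + r) x')" if r: "0 \<le> r" "r \<le> d" for r
  proof -
    have "dist (flow (t2 + r) x) b < e"
      using d(2)[OF r] t2(2) by (metis dist_triangle_half_l dist_commute)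
    then have "le (flow 1 (flow t1 x)) (flow 1 (flow (t2 + r) x))"
      using e(2) t1 t2 r flow_in x by simp
    then have "le x' (flow (1 + (t2 + r)) x)"
      using flow_add[OF x, of 1 t1] flow_add[OF x, of 1 "t2 + r"] t1 t2 r by (simp add: x'_def)
    moreover have "flow (1 + (t2 + r)) x = flow (T + r) x'"
      using flow_add[OF x, of "T + r" "1 + t1"] t1 T r by (simp add: x'_def T_def algebra_simps)
    ultimately show ?thesis by simp
  qed
  have per: "flow (T + r) q = q" if "0 \<le> r" "r \<le> d" "q \<in> \<omega> x'" for r q
    using monotone_times_periodic[OF x' _ le[OF that(1,2)] that(3)] T that by simp
  have "le x' (flow T x')" using le[of 0] d(1) by simp
  then obtain p where p: "p \<in> \<omega> x'" "\<And>q. q \<in> \<omega> x' \<Longrightarrow> \<exists>s\<ge>0. q = flow s p"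
    using monotone_times_limit[OF x' T] by blast
  have pX: "p \<in> X" using p(1) omega_sub x' by blast
  have "flow r p = p" if "0 \<le> r" "r \<le> d" for r
  proof -
    have "flow r p = flow r (flow T p)" using per[of 0 p] p(1) d by simp
    also have "\<dots> = flow (T + r) p"
      using flow_add[OF pX, of r T] that T by (simp add: add.commute)
    finally show ?thesis using per[OF that p(1)] by simp
  qed
  then have "flow s p = p" if "s \<ge> 0" for s
    using fixed_if_locally_fixed[OF pX d(1)] that by blast
  then have "q = p" if "q \<in> \<omega> x'" for q using p(2) that by metis
  moreover have "a \<in> \<omega> x'" "b \<in> \<omega> x'"
    using omega_of_shift[OF x, of "1 + t1"] a b t1 by (auto simp: x'_def)
  ultimately show False using \<open>a \<noteq> b\<close> by metis
qed

lemma colimit_fixed: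
  assumes "x \<in> X" "y \<in> X" "le x y" "x \<noteq> y" and ts: "\<And>n. real n \<le> ts n"
    and lx: "(\<lambda>n. flow (ts n) x) \<longlonglongrightarrow> p" and ly: "(\<lambda>n. flow (ts n) y) \<longlonglongrightarrow> p"
    and "0 \<le> t"
  shows "flow t p = p"
proof -
  have pX: "p \<in> X"
    using omega_sub[OF assms(1)] lx ts by (auto simp: omega_limit_def)
  obtain e where e: "e > 0"
    "\<And>x' y'. x' \<in> X \<Longrightarrow> y' \<in> X \<Longrightarrow> dist x' x < e \<Longrightarrow> dist y' y < e \<Longrightarrow> le (flow 1 x') (flow 1 y')"
    using sop[OF assms(1-4), of 1] by auto
  obtain d1 where d1: "d1 > 0" "\<And>r. 0 \<le> r \<Longrightarrow> r \<le> d1 \<Longrightarrow> dist (flow r x) x < e"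
    using flow_cont_time[OF assms(1), of 0 e] e(1) flow_0[OF assms(1)] by auto
  obtain d2 where d2: "d2 > 0" "\<And>r. 0 \<le> r \<Longrightarrow> r \<le> d2 \<Longrightarrow> dist (flow r y) y < e"
    using flow_cont_time[OF assms(2), of 0 e] e(1) flow_0[OF assms(2)] by auto
  have shift: "(\<lambda>n. flow r (flow (ts (Suc n)) z)) \<longlonglongrightarrow> flow r p"
    if "z \<in> X" "(\<lambda>n. flow (ts n) z) \<longlonglongrightarrow> p" "0 \<le> r" for r z
  proof -
    have "0 \<le> ts (Suc n)" for n using ts[of "Suc n"] by linarith
    then show ?thesis
      using flow_cont[of "\<lambda>_. r" "\<lambda>n. flow (ts (Suc n)) z" p r] that pX flow_in LIMSEQ_Suc[OF that(2)]
      by simp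
  qed
  have regroup: "flow (ts (Suc n) - 1) (flow 1 (flow r z)) = flow r (flow (ts (Suc n)) z)"
    if "z \<in> X" "0 \<le> r" for r z n
  proof -
    have t: "1 \<le> ts (Suc n)" using ts[of "Suc n"] by simp
    have "flow (ts (Suc n) - 1) (flow 1 (flow r z)) = flow (ts (Suc n)) (flow r z)"
      using flow_add[of "flow r z" "ts (Suc n) - 1" 1] t that flow_in by simp
    also have "\<dots> = flow (r + ts (Suc n)) z"
      using flow_add[of z "ts (Suc n)" r] that t by (simp add: add.commute)
    also have "\<dots> = flow r (flow (ts (Suc n)) z)"
      using flow_add[of z r "ts (Suc n)"] that t by simp
    finally show ?thesis .
  qed
  have key: "le (flow r (flow (ts (Suc n)) x)) (flow r' (flow (ts (Suc n)) y))"
    if "0 \<le> r" "r \<le> d1" "0 \<le> r'" "r' \<le> d2" for r r' n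
  proof -
    have "le (flow 1 (flow r x)) (flow 1 (flow r' y))"
      using e(2) that d1 d2 flow_in assms(1,2) by simp
    then have "le (flow (ts (Suc n) - 1) (flow 1 (flow r x))) (flow (ts (Suc n) - 1) (flow 1 (flow r' y)))"
      using flow_mono flow_in assms(1,2) that ts[of "Suc n"] by simp
    then show ?thesis using regroup assms(1,2) that by simp
  qed
  have "flow r p = p" if r: "0 \<le> r" "r \<le> min d1 d2" for r
  proof (rule le_antisym)
    show "le (flow r p) p"
      using le_closed[OF shift[OF assms(1) lx, of r] shift[OF assms(2) ly, of 0] key] r d2 flow_0[OF pX]
      by auto
    show "le p (flow r p)"
      using le_closed[OF shift[OF assms(1) lx, of 0] shift[OF assms(2) ly, of r] key] r d1 flow_0[OF pX]
      by auto
  qed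
  then show ?thesis
    using fixed_if_locally_fixed[OF pX, of "min d1 d2" t] d1 d2 \<open>0 \<le> t\<close> by auto
qed

text \<open>The times \<open>s\<close> with \<open>flow s a \<le> b\<close> form a closed set, which is also open to the right: equality
  \<open>flow s a = b\<close> would put the ordered pair \<open>a < b\<close> into \<open>\<omega> x\<close>, and a strict inequality is an eventual
  inequality between the two orbits by strong monotonicity.\<close>

lemma limits_separate_lower:
  assumes x: "x \<in> X" and y: "y \<in> X" and ts: "\<And>n. real n \<le> ts n"
    and lx: "(\<lambda>n. flow (ts n) x) \<longlonglongrightarrow> a" and ly: "(\<lambda>n. flow (ts n) y) \<longlonglongrightarrow> b"
    and "le a b" "a \<noteq> b" and "0 \<le> s"
  shows "le (flow s a) b"
proof -
  have aw: "a \<in> \<omega> x" and bw: "b \<in> \<omega> y" using ts lx ly by (auto simp: omega_limit_def)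
  have aX: "a \<in> X" and bX: "b \<in> X" using aw bw omega_sub x y by blast+
  have tp: "0 \<le> ts n" for n using ts[of n] by linarith
  have limx: "(\<lambda>n. flow r (flow (ts n) x)) \<longlonglongrightarrow> flow r a" if "0 \<le> r" for r
    using flow_cont[of "\<lambda>_. r" "\<lambda>n. flow (ts n) x" a r] that tp x flow_in lx aX by simp
  have extend: "\<exists>d>0. \<forall>r\<in>{0..d}. le (flow (s + r) a) b" if s: "0 \<le> s" "le (flow s a) b" for s
  proof -
    have "flow s a \<noteq> b"
      using omega_unordered[OF x aw omega_flow[OF x aw s(1)]] \<open>le a b\<close> \<open>a \<noteq> b\<close> by auto
    then obtain e where e: "e > 0"
      "\<And>x' y'. x' \<in> X \<Longrightarrow> y' \<in> X \<Longrightarrow> dist x' (flow s a) < e \<Longrightarrow> dist y' b < e \<Longrightarrow> le (flow 1 x') (flow 1 y')"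
      using sop[OF flow_in[OF aX s(1)] bX s(2), of 1] by auto
    obtain d where d: "d > 0" "\<And>r. 0 \<le> r \<Longrightarrow> r \<le> d \<Longrightarrow> dist (flow (s + r) a) (flow s a) < e / 2"
      using flow_cont_time[OF aX s(1), of "e/2"] e(1) by auto
    have "le (flow (s + r) a) b" if r: "0 \<le> r" "r \<le> d" for r
    proof -
      have sr: "0 \<le> s + r" using s r by simp
      have "\<forall>\<^sub>F n in sequentially. dist (flow (s + r) (flow (ts n) x)) (flow (s + r) a) < e / 2"
        using limx[OF sr] e(1) by (metis half_gt_zero tendstoD)
      moreover have "\<forall>\<^sub>F n in sequentially. dist (flow (ts n) y) b < e"
        using ly e(1) by (metis tendstoD)
      ultimately have "\<forall>\<^sub>F n in sequentially. dist (flow (s + r) (flow (ts n) x)) (flow (s + r) a) < e / 2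
          \<and> dist (flow (ts n) y) b < e"
        by (rule eventually_conj)
      then obtain k where k: "dist (flow (s + r) (flow (ts k) x)) (flow (s + r) a) < e / 2"
          "dist (flow (ts k) y) b < e"
        by (auto simp: eventually_sequentially)
      have "dist (flow (s + r) (flow (ts k) x)) (flow s a) < e"
        using k(1) d(2)[OF r] by (metis dist_triangle_half_l dist_commute)
      then have step: "le (flow 1 (flow (s + r) (flow (ts k) x))) (flow 1 (flow (ts k) y))"
        using e(2) k(2) flow_in x y tp sr by simp
      define M where "M = nat \<lceil>1 + ts k\<rceil>"
      have M: "1 + ts k \<le> ts (n + M)" for n
        using ts[of "n + M"] unfolding M_def by linarith
      have "le (flow (s + r) (flow (ts (n + M)) x)) (flow (ts (n + M)) y)" for n
      proof -
        define u where "u = ts (n + M) - (1 + ts k)"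
        have u: "0 \<le> u" "ts (n + M) = u + (1 + ts k)" using M[of n] by (auto simp: u_def)
        have "le (flow u (flow 1 (flow (s + r) (flow (ts k) x)))) (flow u (flow 1 (flow (ts k) y)))"
          using flow_mono[OF _ _ step u(1)] flow_in x y tp sr by simp
        moreover have "flow u (flow 1 (flow (ts k) y)) = flow (ts (n + M)) y"
          using flow_add[OF y, of u "1 + ts k"] flow_add[OF y, of 1 "ts k"] u tp[of k] by simp
        moreover have "flow u (flow 1 (flow (s + r) (flow (ts k) x))) = flow (s + r) (flow (ts (n + M)) x)"
        proof -
          have "flow u (flow 1 (flow (s + r) (flow (ts k) x))) = flow (u + (1 + (s + r + ts k))) x"
            using flow_add[OF x, of u "1 + (s + r + ts k)"] flow_add[OF x, of 1 "s + r + ts k"]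
              flow_add[OF x, of "s + r" "ts k"] u tp[of k] sr by simp
          also have "u + (1 + (s + r + ts k)) = s + r + ts (n + M)" using u by simp
          finally show ?thesis using flow_add[OF x, of "s + r" "ts (n + M)"] sr tp by simp
        qed
        ultimately show ?thesis by simp
      qed
      then show ?thesis
        using le_closed[OF LIMSEQ_ignore_initial_segment[OF limx[OF sr], of M]
            LIMSEQ_ignore_initial_segment[OF ly, of M]] by blast
    qed
    then show ?thesis using d(1) by auto
  qed
  show ?thesis
  proof (rule ccontr)
    assume neg: "\<not> le (flow s a) b"
    define S where "S = {r. 0 \<le> r \<and> \<not> le (flow r a) b}"
    define m where "m = Inf S"
    have S: "s \<in> S" "bdd_below S" using neg \<open>0 \<le> s\<close> by (auto simp: S_def)
    have m0: "0 \<le> m" unfolding m_def using S by (intro cInf_greatest) (auto simp: S_def)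
    have below: "le (flow r a) b" if "0 \<le> r" "r < m" for r
      using that cInf_lower[of r S] S by (force simp: S_def m_def)
    have "le (flow m a) b"
    proof (cases "m = 0")
      case True then show ?thesis using flow_0 aX \<open>le a b\<close> by simp
    next
      case False
      define rs where "rs n = m - m * inverse (real (Suc n))" for n
      have "rs \<longlonglongrightarrow> m - m * 0"
        unfolding rs_def by (intro tendsto_intros LIMSEQ_inverse_real_of_nat)
      moreover have rs: "0 \<le> rs n" "rs n < m" for n
        using False m0 by (auto simp: rs_def field_simps)
      ultimately have "(\<lambda>n. flow (rs n) a) \<longlonglongrightarrow> flow m a"
        using flow_cont[of rs "\<lambda>_. a" a m] aX by simp
      then show ?thesis using le_closed[OF _ tendsto_const] below rs by blast
    qed
    then obtain d where d: "d > 0" "\<And>r. 0 \<le> r \<Longrightarrow> r \<le> d \<Longrightarrow> le (flow (m + r) a) b"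
      using extend[OF m0] by auto
    have "m + d \<le> r" if "r \<in> S" for r
    proof (rule ccontr)
      assume "\<not> m + d \<le> r"
      then have "le (flow (m + (r - m)) a) b"
        using d(2)[of "r - m"] cInf_lower[OF that S(2)] by (simp add: m_def)
      then show False using that by (simp add: S_def)
    qed
    then have "m + d \<le> m" unfolding m_def using S by (intro cInf_greatest) auto
    then show False using d by simp
  qed
qed

lemma omega_absorb:
  assumes u: "u \<in> X" and v: "v \<in> X" and a: "a \<in> \<omega> u"
    and less: "\<And>e. e \<in> \<omega> v \<Longrightarrow> le a e \<and> a \<noteq> e"
    and c: "c \<in> \<omega> u" and e: "e \<in> \<omega> v"
  shows "le c e"
proof -
  have aX: "a \<in> X" using a u omega_sub by blast
  have "\<exists>d>0. \<forall>x'\<in>X. dist x' a < d \<longrightarrow> (\<forall>w\<in>\<omega> v. le (flow 1 x') (flow 1 w))"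
  proof (rule ccontr)
    assume "\<not> ?thesis"
    then have "\<exists>x'\<in>X. \<exists>w\<in>\<omega> v. dist x' a < d \<and> \<not> le (flow 1 x') (flow 1 w)" if "d > 0" for d
      using that by blast
    from this[of "inverse (real (Suc n))" for n]
    have "\<exists>x'\<in>X. \<exists>w\<in>\<omega> v. dist x' a < inverse (real (Suc n)) \<and> \<not> le (flow 1 x') (flow 1 w)" for n
      by simp
    then obtain xs ws where xs: "\<And>n. xs n \<in> X" "\<And>n. ws n \<in> \<omega> v"
        "\<And>n. dist (xs n) a < inverse (real (Suc n))" "\<And>n. \<not> le (flow 1 (xs n)) (flow 1 (ws n))"
      by metis
    obtain w r where w: "w \<in> \<omega> v" "strict_mono r" "(ws \<circ> r) \<longlonglongrightarrow> w"
      using compact_omega[OF v] xs(2) unfolding compact_def by metis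
    have "(\<lambda>n. dist (xs n) a) \<longlonglongrightarrow> 0"
      by (rule tendsto_sandwich[OF _ _ tendsto_const LIMSEQ_inverse_real_of_nat])
         (auto intro!: always_eventually less_imp_le[OF xs(3)] simp del: of_nat_Suc)
    then have "xs \<longlonglongrightarrow> a" using tendsto_dist_iff by blast
    then have "(xs \<circ> r) \<longlonglongrightarrow> a" using LIMSEQ_subseq_LIMSEQ w(2) by blast
    have wX: "w \<in> X" using w(1) v omega_sub by blast
    obtain d where d: "d > 0"
      "\<And>x' y'. x' \<in> X \<Longrightarrow> y' \<in> X \<Longrightarrow> dist x' a < d \<Longrightarrow> dist y' w < d \<Longrightarrow> le (flow 1 x') (flow 1 y')"
      using sop[OF aX wX, of 1] less[OF w(1)] by auto
    have "\<forall>\<^sub>F n in sequentially. dist ((xs \<circ> r) n) a < d \<and> dist ((ws \<circ> r) n) w < d"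
      using eventually_conj[OF tendstoD[OF \<open>(xs \<circ> r) \<longlonglongrightarrow> a\<close> d(1)] tendstoD[OF w(3) d(1)]] .
    then obtain n where "dist (xs (r n)) a < d" "dist (ws (r n)) w < d"
      by (auto simp: eventually_sequentially)
    then show False using d(2) xs omega_sub[OF v] by blast
  qed
  then obtain d where d: "d > 0"
    "\<And>x' w. x' \<in> X \<Longrightarrow> dist x' a < d \<Longrightarrow> w \<in> \<omega> v \<Longrightarrow> le (flow 1 x') (flow 1 w)"
    by blast
  obtain t1 where t1: "t1 \<ge> 0" "dist (flow t1 u) a < d"
    using a d(1) unfolding omega_limit_iff by blast
  have low: "le (flow ((1 + t1) + t) u) e" if t: "0 \<le> t" for t
  proof -
    obtain w where w: "w \<in> \<omega> v" "flow (t + 1) w = e"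
      using omega_preimage[OF v e, of "t + 1"] t by auto
    have wX: "w \<in> X" using w(1) v omega_sub by blast
    have "le (flow 1 (flow t1 u)) (flow 1 w)" using d(2) t1 w(1) flow_in u by simp
    then have "le (flow t (flow 1 (flow t1 u))) (flow t (flow 1 w))"
      using flow_mono t flow_in u t1 wX by simp
    moreover have "flow t (flow 1 w) = e" using flow_add[OF wX, of t 1] t w by simp
    moreover have "flow t (flow 1 (flow t1 u)) = flow ((1 + t1) + t) u"
      using flow_add[OF u, of t "1 + t1"] flow_add[OF u, of 1 t1] t t1 by (simp add: add.commute)
    ultimately show ?thesis by simp
  qed
  obtain ts where ts: "\<And>n. real n \<le> ts n" "(\<lambda>n. flow ((1 + t1) + ts n) u) \<longlonglongrightarrow> c"
    using omega_shift_times[OF c] by blast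
  have "0 \<le> ts n" for n using ts(1)[of n] by linarith
  then show ?thesis
    using le_closed[OF ts(2) tendsto_const] low by blast
qed

theorem omega_ordered:
  assumes x: "x \<in> X" and y: "y \<in> X" and xy: "le x y" "x \<noteq> y"
    and a: "a \<in> \<omega> x" and na: "0 \<le> t" "flow t a \<noteq> a"
    and c: "c \<in> \<omega> x" and e: "e \<in> \<omega> y"
  shows "le c e"
proof -
  interpret dual: sop_semiflow X flow "\<lambda>x y. le y x" by (rule dual)
  obtain ts0 where ts0: "\<And>n. real n \<le> ts0 n" "(\<lambda>n. flow (ts0 n) x) \<longlonglongrightarrow> a"
    using a by (auto simp: omega_limit_def)
  obtain r b where r: "strict_mono r" "b \<in> \<omega> y" "(\<lambda>n. flow (ts0 (r n)) y) \<longlonglongrightarrow> b"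
    "\<And>n. real n \<le> ts0 (r n)"
    using subseq_limit[OF y ts0(1)] by blast
  define ts where "ts n = ts0 (r n)" for n
  have ts: "real n \<le> ts n" for n using r(4) by (simp add: ts_def)
  have tp: "0 \<le> ts n" for n using ts[of n] by linarith
  have ly: "(\<lambda>n. flow (ts n) y) \<longlonglongrightarrow> b" using r(3) by (simp add: ts_def)
  have lx: "(\<lambda>n. flow (ts n) x) \<longlonglongrightarrow> a"
    using LIMSEQ_subseq_LIMSEQ[OF ts0(2) r(1)] by (simp add: comp_def ts_def)
  have ab: "le a b" using le_closed[OF lx ly] flow_mono[OF x y xy(1) tp] by blast
  have "a \<noteq> b" using colimit_fixed[OF x y xy ts lx _ na(1)] ly na(2) by blast
  have bX: "b \<in> X" using r(2) y omega_sub by blast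
  have le_orb: "le a (flow s b)" if "0 \<le> s" for s
    using dual.limits_separate_lower[OF y x ts ly lx ab _ that] \<open>a \<noteq> b\<close> by simp
  have le_b: "le a w" if w: "w \<in> \<omega> b" for w
  proof -
    obtain ss where ss: "\<And>n. real n \<le> ss n" "(\<lambda>n. flow (ss n) b) \<longlonglongrightarrow> w"
      using w by (auto simp: omega_limit_def)
    have "0 \<le> ss n" for n using ss(1)[of n] by linarith
    then show ?thesis
      using le_closed[OF tendsto_const ss(2)] le_orb by blast
  qed
  have sub: "\<omega> b \<subseteq> \<omega> y" using omega_trans[OF y r(2)] .
  have lt_b: "le a w \<and> a \<noteq> w" if "w \<in> \<omega> b" for w
    using le_b[OF that] omega_unordered[OF y _ r(2) ab] sub that \<open>a \<noteq> b\<close> by blast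
  have below: "le c' w" if "c' \<in> \<omega> x" "w \<in> \<omega> b" for c' w
    using omega_absorb[OF x bX a lt_b] that by blast
  obtain w where w: "w \<in> \<omega> b" using omega_nonempty[OF bX] by blast
  have "le c' w \<and> w \<noteq> c'" if "c' \<in> \<omega> x" for c'
    using below[OF that w] omega_unordered[OF x a that] lt_b[OF w] by blast
  then show ?thesis
    using dual.omega_absorb[OF y x _ _ e c] w sub by blast
qed

lemma omega_eq_Inter:
  assumes "x \<in> X"
  shows "\<omega> x = (\<Inter>T\<in>{0..}. closure ((\<lambda>t. flow t x) ` {T..}))"
proof
  show "\<omega> x \<subseteq> (\<Inter>T\<in>{0..}. closure ((\<lambda>t. flow t x) ` {T..}))"
    by (auto simp: omega_limit_iff closure_approachable Bex_def)
  show "(\<Inter>T\<in>{0..}. closure ((\<lambda>t. flow t x) ` {T..})) \<subseteq> \<omega> x"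
  proof
    fix p assume p: "p \<in> (\<Inter>T\<in>{0..}. closure ((\<lambda>t. flow t x) ` {T..}))"
    show "p \<in> \<omega> x"
      unfolding omega_limit_iff
    proof (intro allI impI)
      fix e T :: real assume "e > 0"
      have "p \<in> closure ((\<lambda>t. flow t x) ` {max 0 T..})" using p by auto
      then obtain t where "t \<ge> max 0 T" "dist (flow t x) p < e"
        using \<open>e > 0\<close> unfolding closure_approachable by auto
      then show "\<exists>t\<ge>T. dist (flow t x) p < e" by auto
    qed
  qed
qed

lemma continuous_on_flow_time: "x \<in> X \<Longrightarrow> continuous_on {0..} (\<lambda>t. flow t x)"
  unfolding continuous_on_sequentially comp_def by (auto intro!: flow_cont)

lemma connected_omega:
  assumes x: "x \<in> X"
  shows "connected (\<omega> x)"
proof -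
  define C where "C T = closure ((\<lambda>t. flow t x) ` {T..})" for T :: real
  have "connected (\<Inter>(C ` {0..}))"
  proof (rule connected_chain)
    fix S assume "S \<in> C ` {0..}"
    then obtain T where T: "0 \<le> T" "S = C T" by auto
    have "(\<lambda>t. flow t x) ` {T..} \<subseteq> X" using flow_in x T by auto
    then have "C T \<subseteq> X"
      unfolding C_def using compact_imp_closed[OF compact_X] by (rule closure_minimal)
    then have "compact (C T)"
      unfolding C_def using compact_X by (metis closed_closure compact_Int_closed inf.absorb2)
    moreover have "connected (C T)"
      unfolding C_def using T continuous_on_flow_time[OF x]
      by (intro connected_imp_connected_closure connected_continuous_image)
         (auto intro: continuous_on_subset)
    ultimately show "compact S \<and> connected S" using T by simp
  next
    fix S S' assume "S \<in> C ` {0..} \<and> S' \<in> C ` {0..}"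
    then obtain T T' where "S = C T" "S' = C T'" by auto
    moreover have "C T \<subseteq> C T'" if "T' \<le> T" for T T'
      unfolding C_def using that by (intro closure_mono image_mono) auto
    ultimately show "S \<subseteq> S' \<or> S' \<subseteq> S" by (meson linear)
  qed
  then show ?thesis using omega_eq_Inter[OF x] by (simp add: C_def)
qed

lemma tendsto_if_omega_subset_singleton:
  assumes x: "x \<in> X" and "\<omega> x \<subseteq> {p}"
  shows "((\<lambda>t. flow t x) \<longlongrightarrow> p) at_top"
proof (rule tendsto_at_topI_sequentially)
  fix ts :: "nat \<Rightarrow> real" assume ts: "filterlim ts at_top sequentially"
  then obtain N where N: "\<And>n. n \<ge> N \<Longrightarrow> 0 \<le> ts n"
    unfolding filterlim_at_top eventually_sequentially by blast
  have "(\<lambda>n. flow (ts (n + N)) x) \<longlonglongrightarrow> p"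
  proof (rule compact_unique_limit[OF compact_X])
    show "flow (ts (n + N)) x \<in> X" for n using N flow_in x by simp
    fix r q assume r: "strict_mono r" "((\<lambda>n. flow (ts (n + N)) x) \<circ> r) \<longlonglongrightarrow> q"
    have top: "filterlim (\<lambda>n. ts (r n + N)) at_top sequentially"
      using r(1) by (intro filterlim_compose[OF ts] filterlim_subseq) (simp add: strict_mono_def)
    have "q \<in> \<omega> x"
      unfolding omega_limit_iff
    proof (intro allI impI)
      fix e T :: real assume "e > 0"
      then have "\<forall>\<^sub>F n in sequentially. dist (flow (ts (r n + N)) x) q < e"
        using tendstoD[OF r(2)] by (simp add: comp_def)
      moreover have "\<forall>\<^sub>F n in sequentially. T \<le> ts (r n + N)"
        using top unfolding filterlim_at_top by blast
      ultimately have "\<forall>\<^sub>F n in sequentially. dist (flow (ts (r n + N)) x) q < e \<and> T \<le> ts (r n + N)"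
        by (rule eventually_conj)
      then show "\<exists>t\<ge>T. dist (flow t x) q < e" by (auto simp: eventually_sequentially)
    qed
    then show "q = p" using assms(2) by blast
  qed
  then show "(\<lambda>n. flow (ts n) x) \<longlonglongrightarrow> p" by (rule LIMSEQ_offset)
qed

end

section \<open>Cooperative differential equations\<close>

lemma exponential_bound:
  fixes V V' :: "real \<Rightarrow> real"
  assumes "0 \<le> a" "a \<le> b"
    and der: "\<And>t. a \<le> t \<Longrightarrow> t \<le> b \<Longrightarrow> (V has_real_derivative V' t) (at t within {0..})"
    and le: "\<And>t. a \<le> t \<Longrightarrow> t \<le> b \<Longrightarrow> V' t \<le> C * V t"
  shows "V b \<le> exp (C * (b - a)) * V a"
proof (cases "a = b")
  case False
  with \<open>a \<le> b\<close> have "a < b" by simp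
  define W where "W t = exp (- C * t) * V t" for t
  have dW: "(W has_real_derivative exp (- C * t) * (V' t - C * V t)) (at t within {0..})"
    if "a \<le> t" "t \<le> b" for t
    unfolding W_def using der[OF that]
    by (auto intro!: derivative_eq_intros simp: algebra_simps)
  have "W b \<le> W a"
  proof (rule DERIV_nonpos_imp_decreasing_open[OF \<open>a \<le> b\<close>])
    fix t assume t: "a < t" "t < b"
    have "at t within {0..} = at t"
      using t assms(1) by (intro at_within_interior) simp
    then have "DERIV W t :> exp (- C * t) * (V' t - C * V t)"
      using dW[of t] t by simp
    moreover have "exp (- C * t) * (V' t - C * V t) \<le> 0"
      using le[of t] t by (simp add: mult_nonneg_nonpos)
    ultimately show "\<exists>y. DERIV W t :> y \<and> y \<le> 0" by blast
  next
    show "continuous_on {a..b} W"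
      unfolding continuous_on_eq_continuous_within
    proof
      fix t assume "t \<in> {a..b}"
      then have "continuous (at t within {0..}) W"
        using dW DERIV_continuous by (metis atLeastAtMost_iff)
      then show "continuous (at t within {a..b}) W"
        by (rule continuous_within_subset) (use assms in auto)
    qed
  qed
  then have "exp (C * b) * W b \<le> exp (C * b) * W a"
    by (intro mult_left_mono) auto
  moreover have "exp (C * b) * W b = V b"
    unfolding W_def mult.assoc[symmetric] exp_add[symmetric] by simp
  moreover have "exp (C * b) * W a = exp (C * (b - a)) * V a"
    unfolding W_def mult.assoc[symmetric] exp_add[symmetric] by (simp add: right_diff_distrib)
  ultimately show ?thesis by simp
qed simp

lemma solutions_dist_bound:
  fixes u v :: "real \<Rightarrow> 'a::real_inner"
  assumes lip: "L-lipschitz_on K F" and "0 \<le> T"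
    and u: "\<And>t. 0 \<le> t \<Longrightarrow> t \<le> T \<Longrightarrow> (u has_vector_derivative F (u t)) (at t within {0..})"
    and v: "\<And>t. 0 \<le> t \<Longrightarrow> t \<le> T \<Longrightarrow> (v has_vector_derivative F (v t)) (at t within {0..})"
    and K: "\<And>t. 0 \<le> t \<Longrightarrow> t \<le> T \<Longrightarrow> u t \<in> K \<and> v t \<in> K"
  shows "dist (u T) (v T) \<le> exp (L * T) * dist (u 0) (v 0)"
proof -
  define V where "V t = (u t - v t) \<bullet> (u t - v t)" for t
  define V' where "V' t = (u t - v t) \<bullet> (F (u t) - F (v t)) + (F (u t) - F (v t)) \<bullet> (u t - v t)" for t
  have "V T \<le> exp ((2 * L) * (T - 0)) * V 0"
  proof (rule exponential_bound[of _ _ _ V'])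
    fix t assume t: "0 \<le> t" "t \<le> T"
    have "((\<lambda>t. u t - v t) has_vector_derivative F (u t) - F (v t)) (at t within {0..})"
      using u[OF t] v[OF t] by (rule has_vector_derivative_diff)
    then show "(V has_real_derivative V' t) (at t within {0..})"
      unfolding V_def V'_def has_real_derivative_iff_has_vector_derivative
      by (rule bounded_bilinear.has_vector_derivative[OF bounded_bilinear_inner, rotated]) fact
    have "(u t - v t) \<bullet> (F (u t) - F (v t)) \<le> norm (u t - v t) * norm (F (u t) - F (v t))"
      by (rule norm_cauchy_schwarz)
    also have "\<dots> \<le> norm (u t - v t) * (L * norm (u t - v t))"
      using lipschitz_onD[OF lip, of "u t" "v t"] K[OF t]
      by (intro mult_left_mono) (auto simp: dist_norm)
    also have "\<dots> = L * V t"
      by (simp add: V_def power2_norm_eq_inner[symmetric] power2_eq_square)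
    finally show "V' t \<le> 2 * L * V t"
      by (simp add: V'_def inner_commute)
  qed (use \<open>0 \<le> T\<close> in auto)
  then have "(norm (u T - v T))\<^sup>2 \<le> (exp (L * T) * norm (u 0 - v 0))\<^sup>2"
    by (simp add: V_def power2_norm_eq_inner[symmetric] power_mult_distrib exp_double[symmetric] mult.assoc)
  then show ?thesis
    unfolding dist_norm by (rule power2_le_imp_le) simp
qed

lemma solutions_limit:
  fixes us :: "nat \<Rightarrow> real \<Rightarrow> 'a::euclidean_space"
  assumes lip: "L-lipschitz_on K F" and "closed K"
    and der: "\<And>n t. 0 \<le> t \<Longrightarrow> (us n has_vector_derivative F (us n t)) (at t within {0..})"
    and K: "\<And>n t. 0 \<le> t \<Longrightarrow> us n t \<in> K"
    and lim: "(\<lambda>n. us n 0) \<longlonglongrightarrow> x"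
  obtains u where "u 0 = x" "\<And>t. 0 \<le> t \<Longrightarrow> u t \<in> K"
    "\<And>t. 0 \<le> t \<Longrightarrow> (u has_vector_derivative F (u t)) (at t within {0..})"
proof -
  have L: "0 \<le> L" using lip lipschitz_on_nonneg by blast
  have dist: "dist (us m t) (us n t) \<le> exp (L * t) * dist (us m 0) (us n 0)" if "0 \<le> t" for m n t
    using solutions_dist_bound[OF lip that, of "us m" "us n"] der K by blast
  have "Cauchy (\<lambda>n. us n t)" if t: "0 \<le> t" for t
  proof (rule metric_CauchyI)
    fix e :: real assume "e > 0"
    then have "e / exp (L * t) > 0" by simp
    then obtain M where M: "\<And>m n. m \<ge> M \<Longrightarrow> n \<ge> M \<Longrightarrow> dist (us m 0) (us n 0) < e / exp (L * t)"
      using metric_CauchyD[OF LIMSEQ_imp_Cauchy[OF lim]] by blast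
    have "dist (us m t) (us n t) < e" if "m \<ge> M" "n \<ge> M" for m n
      using dist[OF t, of m n] M[OF that] by (simp add: field_simps)
    then show "\<exists>M. \<forall>m\<ge>M. \<forall>n\<ge>M. dist (us m t) (us n t) < e" by blast
  qed
  then have "\<exists>l. (\<lambda>n. us n t) \<longlonglongrightarrow> l" if "0 \<le> t" for t
    using that Cauchy_convergent convergent_def by blast
  then obtain u where u: "\<And>t. 0 \<le> t \<Longrightarrow> (\<lambda>n. us n t) \<longlonglongrightarrow> u t" by metis
  have uK: "u t \<in> K" if "0 \<le> t" for t
    by (rule closed_sequentially[OF \<open>closed K\<close> _ u[OF that]]) (use K that in auto)
  have u0: "u 0 = x" using u[of 0] lim LIMSEQ_unique by auto
  have distu: "dist (us n t) (u t) \<le> exp (L * t) * dist (us n 0) x" if "0 \<le> t" for n t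
  proof (rule LIMSEQ_le)
    show "(\<lambda>m. dist (us n t) (us m t)) \<longlonglongrightarrow> dist (us n t) (u t)"
      by (intro tendsto_intros u that)
    show "(\<lambda>m. exp (L * t) * dist (us n 0) (us m 0)) \<longlonglongrightarrow> exp (L * t) * dist (us n 0) x"
      by (intro tendsto_intros lim)
  qed (use dist[OF that] in auto)
  have "(u has_vector_derivative F (u t)) (at t within {0..})" if t: "0 \<le> t" for t
  proof -
    define T where "T = t + 1"
    have "\<exists>g. \<forall>s\<in>{0..T}. (\<lambda>n. us n s) \<longlonglongrightarrow> g s \<and>
            (g has_derivative (\<lambda>h. h *\<^sub>R F (u s))) (at s within {0..T})"
    proof (rule has_derivative_sequence[where f' = "\<lambda>n s h. h *\<^sub>R F (us n s)"])
      fix n s assume "s \<in> {0..T}"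
      then show "(us n has_derivative (\<lambda>h. h *\<^sub>R F (us n s))) (at s within {0..T})"
        using der[of s n] unfolding has_vector_derivative_def
        by (auto intro: has_derivative_subset)
    next
      fix e :: real assume "e > 0"
      define c where "c = L * exp (L * T)"
      have "(\<lambda>n. c * dist (us n 0) x) \<longlonglongrightarrow> c * dist x x"
        by (intro tendsto_intros lim)
      then have "\<forall>\<^sub>F n in sequentially. c * dist (us n 0) x < e"
        using \<open>e > 0\<close> order_tendstoD(2) by fastforce
      then show "\<forall>\<^sub>F n in sequentially. \<forall>s\<in>{0..T}. \<forall>h.
          norm (h *\<^sub>R F (us n s) - h *\<^sub>R F (u s)) \<le> e * norm h"
      proof (rule eventually_mono, intro ballI allI)
        fix n s and h :: real assume n: "c * dist (us n 0) x < e" and s: "s \<in> {0..T}"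
        have "dist (F (us n s)) (F (u s)) \<le> L * dist (us n s) (u s)"
          using lipschitz_onD[OF lip] K uK s by simp
        also have "\<dots> \<le> L * (exp (L * s) * dist (us n 0) x)"
          using distu[of s n] L s by (intro mult_left_mono) auto
        also have "\<dots> \<le> L * (exp (L * T) * dist (us n 0) x)"
          using L s by (intro mult_left_mono mult_right_mono) (auto intro: mult_left_mono)
        also have "\<dots> \<le> e" using n by (simp add: c_def)
        finally have "\<bar>h\<bar> * norm (F (us n s) - F (u s)) \<le> \<bar>h\<bar> * e"
          by (intro mult_left_mono) (auto simp: dist_norm)
        then show "norm (h *\<^sub>R F (us n s) - h *\<^sub>R F (u s)) \<le> e * norm h"
          by (simp add: scaleR_diff_right[symmetric] mult.commute)
      qed
    qed (use lim t in \<open>auto simp: T_def\<close>)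
    then obtain g where g: "\<And>s. s \<in> {0..T} \<Longrightarrow> (\<lambda>n. us n s) \<longlonglongrightarrow> g s"
      "\<And>s. s \<in> {0..T} \<Longrightarrow> (g has_derivative (\<lambda>h. h *\<^sub>R F (u s))) (at s within {0..T})" by blast
    have gu: "g s = u s" if "s \<in> {0..T}" for s
      using LIMSEQ_unique[OF g(1)[OF that] u] that by simp
    have "(u has_derivative (\<lambda>h. h *\<^sub>R F (u t))) (at t within {0..T})"
      using t gu by (intro has_derivative_transform[OF _ _ g(2)]) (auto simp: T_def)
    moreover have "at t within {0..T} = at t within {0..}"
      by (rule at_within_nhd[of _ "{..<T}"]) (auto simp: T_def)
    ultimately show ?thesis by (simp add: has_vector_derivative_def)
  qed
  with u0 uK show ?thesis using that by blast
qed

definition sign_le :: "'a::euclidean_space \<Rightarrow> 'a \<Rightarrow> 'a \<Rightarrow> bool" where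
  "sign_le \<sigma> x y \<longleftrightarrow> (\<forall>i\<in>Basis. (\<sigma> \<bullet> i) * (x \<bullet> i) \<le> (\<sigma> \<bullet> i) * (y \<bullet> i))"

lemma has_real_derivative_pos_part_squared:
  "((\<lambda>x::real. (max 0 x)\<^sup>2) has_real_derivative 2 * max 0 x) (at x)"
proof -
  consider "x < 0" | "x > 0" | "x = 0" by linarith
  then show ?thesis
  proof cases
    case 1
    have "((\<lambda>x::real. 0) has_real_derivative 2 * max 0 x) (at x)" using 1 by simp
    then show ?thesis
      by (rule has_field_derivative_transform_within_open[of _ _ _ "{..<0}"]) (use 1 in auto)
  next
    case 2
    have "((\<lambda>x::real. x\<^sup>2) has_real_derivative 2 * max 0 x) (at x)"
      using 2 by (auto intro!: derivative_eq_intros)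
    then show ?thesis
      by (rule has_field_derivative_transform_within_open[of _ _ _ "{0<..}"]) (use 2 in auto)
  next
    case 3
    have "((\<lambda>h::real. (max 0 h)\<^sup>2 / h) \<longlongrightarrow> 0) (at 0)"
    proof (rule Lim_null_comparison)
      show "((\<lambda>h::real. \<bar>h\<bar>) \<longlongrightarrow> 0) (at 0)" by (rule tendsto_rabs_zero) (rule tendsto_ident_at)
      show "\<forall>\<^sub>F h in at 0. norm ((max 0 h)\<^sup>2 / h :: real) \<le> \<bar>h\<bar>"
        by (rule always_eventually) (auto simp: max_def power2_eq_square)
    qed
    then show ?thesis using 3 by (simp add: DERIV_def)
  qed
qed

locale cooperative_field =
  fixes \<sigma> lo hi :: "'a::euclidean_space" and F :: "'a \<Rightarrow> 'a" and L :: real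
  assumes sigma: "i \<in> Basis \<Longrightarrow> \<bar>\<sigma> \<bullet> i\<bar> = 1"
    and lip: "L-lipschitz_on (cbox lo hi) F"
    and quasi: "x \<in> cbox lo hi \<Longrightarrow> y \<in> cbox lo hi \<Longrightarrow> sign_le \<sigma> x y \<Longrightarrow> i \<in> Basis \<Longrightarrow> x \<bullet> i = y \<bullet> i
      \<Longrightarrow> (\<sigma> \<bullet> i) * (F x \<bullet> i) \<le> (\<sigma> \<bullet> i) * (F y \<bullet> i)"
begin

lemma sigma_square: "i \<in> Basis \<Longrightarrow> (\<sigma> \<bullet> i)\<^sup>2 = 1"
  using sigma[of i] by (metis one_power2 power2_abs)

lemma sigma_bound: "i \<in> Basis \<Longrightarrow> (\<sigma> \<bullet> i) * c \<le> \<bar>c\<bar>"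
  using sigma[of i] by (metis abs_ge_self abs_mult mult_1)

lemma L_nonneg: "0 \<le> L"
  using lip lipschitz_on_nonneg by blast

lemma solution_component:
  assumes "(u has_vector_derivative F (u t)) (at t within {0..})"
  shows "((\<lambda>t. c * (u t \<bullet> i)) has_real_derivative c * (F (u t) \<bullet> i)) (at t within {0..})"
proof -
  have "((\<lambda>t. u t \<bullet> i) has_vector_derivative F (u t) \<bullet> i) (at t within {0..})"
    by (rule bounded_linear.has_vector_derivative[OF bounded_linear_inner_left assms])
  then show ?thesis
    by (intro DERIV_cmult) (simp add: has_real_derivative_iff_has_vector_derivative)
qed

text \<open>Gronwall's inequality for the squared norm of the part of \<open>u - v\<close> violating the order; \<open>w\<close> is the join
  of \<open>u t\<close> and \<open>v t\<close>.\<close>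

lemma comparison:
  assumes u: "\<And>t. 0 \<le> t \<Longrightarrow> (u has_vector_derivative F (u t)) (at t within {0..})"
    and v: "\<And>t. 0 \<le> t \<Longrightarrow> (v has_vector_derivative F (v t)) (at t within {0..})"
    and uK: "\<And>t. 0 \<le> t \<Longrightarrow> u t \<in> cbox lo hi" and vK: "\<And>t. 0 \<le> t \<Longrightarrow> v t \<in> cbox lo hi"
    and init: "sign_le \<sigma> (u 0) (v 0)" and "0 \<le> T"
  shows "sign_le \<sigma> (u T) (v T)"
proof -
  define d where "d i t = (\<sigma> \<bullet> i) * (u t \<bullet> i) - (\<sigma> \<bullet> i) * (v t \<bullet> i)" for i t
  define d' where "d' i t = (\<sigma> \<bullet> i) * (F (u t) \<bullet> i) - (\<sigma> \<bullet> i) * (F (v t) \<bullet> i)" for i t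
  define V where "V t = (\<Sum>i\<in>Basis. (max 0 (d i t))\<^sup>2)" for t
  define V' where "V' t = (\<Sum>i\<in>Basis. 2 * max 0 (d i t) * d' i t)" for t
  have V0: "0 \<le> V t" for t by (simp add: V_def sum_nonneg)
  have comp: "max 0 (d i t) \<le> sqrt (V t)" if "i \<in> Basis" for i t
    unfolding V_def by (intro real_le_rsqrt member_le_sum) (use that in auto)
  have "V T \<le> exp ((2 * L * DIM('a)) * (T - 0)) * V 0"
  proof (rule exponential_bound[of _ _ _ V'])
    fix t :: real assume t: "0 \<le> t"
    have "(d i has_real_derivative d' i t) (at t within {0..})" for i
      unfolding d_def d'_def by (intro DERIV_diff solution_component u v t)
    then show "(V has_real_derivative V' t) (at t within {0..})"
      unfolding V_def V'_def
      by (intro DERIV_sum DERIV_chain2[OF has_real_derivative_pos_part_squared])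
    define w where "w = (\<Sum>i\<in>Basis. (if d i t \<ge> 0 then u t \<bullet> i else v t \<bullet> i) *\<^sub>R i)"
    have w: "w \<bullet> i = (if d i t \<ge> 0 then u t \<bullet> i else v t \<bullet> i)" if "i \<in> Basis" for i
      unfolding w_def using that by (rule inner_sum_left_Basis)
    have wK: "w \<in> cbox lo hi"
      using uK[OF t] vK[OF t] by (auto simp: mem_box w)
    have uw: "sign_le \<sigma> (u t) w"
      by (auto simp: sign_le_def w d_def)
    have "(norm (w - v t))\<^sup>2 = (\<Sum>i\<in>Basis. ((w - v t) \<bullet> i)\<^sup>2)"
      by (subst power2_norm_eq_inner, subst euclidean_inner) (simp add: power2_eq_square)
    also have "\<dots> = V t"
      unfolding V_def
    proof (rule sum.cong[OF refl])
      fix i :: 'a assume i: "i \<in> Basis"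
      have "(d i t)\<^sup>2 = (\<sigma> \<bullet> i)\<^sup>2 * (u t \<bullet> i - v t \<bullet> i)\<^sup>2"
        by (simp add: d_def right_diff_distrib[symmetric] power_mult_distrib)
      then show "((w - v t) \<bullet> i)\<^sup>2 = (max 0 (d i t))\<^sup>2"
        using sigma_square[OF i] by (auto simp: inner_diff_left w[OF i] max_def)
    qed
    finally have nw: "norm (w - v t) = sqrt (V t)"
      by (metis norm_ge_zero real_sqrt_abs abs_of_nonneg)
    have "2 * max 0 (d i t) * d' i t \<le> 2 * L * V t" if i: "i \<in> Basis" for i
    proof (cases "d i t > 0")
      case True
      have "d' i t \<le> (\<sigma> \<bullet> i) * (F w \<bullet> i) - (\<sigma> \<bullet> i) * (F (v t) \<bullet> i)"
        using quasi[OF uK[OF t] wK uw i] w[OF i] True by (simp add: d'_def)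
      also have "\<dots> \<le> \<bar>(F w - F (v t)) \<bullet> i\<bar>"
        using sigma_bound[OF i, of "(F w - F (v t)) \<bullet> i"] by (simp add: inner_diff_left right_diff_distrib)
      also have "\<dots> \<le> norm (F w - F (v t))" using i by (rule Basis_le_norm)
      also have "\<dots> \<le> L * norm (w - v t)"
        using lipschitz_onD[OF lip wK vK[OF t]] by (simp add: dist_norm)
      finally have "d' i t \<le> L * sqrt (V t)" using nw by simp
      then have "max 0 (d i t) * d' i t \<le> max 0 (d i t) * (L * sqrt (V t))"
        by (intro mult_left_mono) auto
      also have "\<dots> \<le> sqrt (V t) * (L * sqrt (V t))"
        using comp[OF i] L_nonneg V0 by (intro mult_right_mono) auto
      also have "\<dots> = L * V t" using V0 by simp
      finally show ?thesis by simp
    next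
      case False
      then show ?thesis using V0 L_nonneg by (simp add: max_def)
    qed
    then have "V' t \<le> (\<Sum>i\<in>(Basis::'a set). 2 * L * V t)"
      unfolding V'_def by (rule sum_mono)
    then show "V' t \<le> 2 * L * DIM('a) * V t" by (simp add: algebra_simps)
  qed (use \<open>0 \<le> T\<close> in auto)
  moreover have "V 0 = 0"
    unfolding V_def by (rule sum.neutral) (use init in \<open>auto simp: d_def sign_le_def\<close>)
  ultimately have "V T = 0" using V0[of T] by simp
  have "d i T \<le> 0" if "i \<in> Basis" for i
  proof -
    have "max 0 (d i T) = 0"
      using that \<open>V T = 0\<close> by (simp add: V_def sum_nonneg_eq_0_iff)
    then show ?thesis by (simp add: max_def split: if_splits)
  qed
  then show ?thesis
    by (simp add: sign_le_def d_def)
qed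

lemma gap_persists:
  assumes u: "\<And>t. 0 \<le> t \<Longrightarrow> (u has_vector_derivative F (u t)) (at t within {0..})"
    and v: "\<And>t. 0 \<le> t \<Longrightarrow> (v has_vector_derivative F (v t)) (at t within {0..})"
    and uK: "\<And>t. 0 \<le> t \<Longrightarrow> u t \<in> cbox lo hi" and vK: "\<And>t. 0 \<le> t \<Longrightarrow> v t \<in> cbox lo hi"
    and init: "sign_le \<sigma> (u 0) (v 0)" and "0 \<le> a" "a \<le> b" and i: "i \<in> Basis"
    and eq: "u b \<bullet> i = v b \<bullet> i"
  shows "u a \<bullet> i = v a \<bullet> i"
proof -
  define g where "g t = (\<sigma> \<bullet> i) * (u t \<bullet> i) - (\<sigma> \<bullet> i) * (v t \<bullet> i)" for t
  define g' where "g' t = (\<sigma> \<bullet> i) * (F (u t) \<bullet> i) - (\<sigma> \<bullet> i) * (F (v t) \<bullet> i)" for t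
  have ord: "sign_le \<sigma> (u t) (v t)" if "0 \<le> t" for t
    using comparison[OF u v uK vK init that] .
  have g_le: "g t \<le> 0" if "0 \<le> t" for t
    using ord[OF that] i by (simp add: sign_le_def g_def)
  have "g b \<le> exp ((- L) * (b - a)) * g a"
  proof (rule exponential_bound[of _ _ _ g'])
    fix t assume "a \<le> t" "t \<le> b"
    then have t: "0 \<le> t" using \<open>0 \<le> a\<close> by simp
    show "(g has_real_derivative g' t) (at t within {0..})"
      unfolding g_def g'_def by (intro DERIV_diff solution_component u v t)
    define w where "w = u t + ((v t - u t) \<bullet> i) *\<^sub>R i"
    have w: "w \<bullet> j = (if j = i then v t \<bullet> i else u t \<bullet> j)" if "j \<in> Basis" for j
      using that i by (auto simp: w_def inner_add_left inner_diff_left inner_Basis)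
    have wK: "w \<in> cbox lo hi"
      using uK[OF t] vK[OF t] by (auto simp: mem_box w)
    have wv: "sign_le \<sigma> w (v t)"
      using ord[OF t] by (auto simp: sign_le_def w)
    have "g' t \<le> (\<sigma> \<bullet> i) * (F (u t) \<bullet> i) - (\<sigma> \<bullet> i) * (F w \<bullet> i)"
      using quasi[OF wK vK[OF t] wv i] w[OF i] by (simp add: g'_def)
    also have "\<dots> \<le> \<bar>(F (u t) - F w) \<bullet> i\<bar>"
      using sigma_bound[OF i, of "(F (u t) - F w) \<bullet> i"] by (simp add: inner_diff_left right_diff_distrib)
    also have "\<dots> \<le> norm (F (u t) - F w)" using i by (rule Basis_le_norm)
    also have "\<dots> \<le> L * norm (u t - w)"
      using lipschitz_onD[OF lip uK[OF t] wK] by (simp add: dist_norm)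
    also have "norm (u t - w) = \<bar>g t\<bar>"
      using i sigma[OF i]
      by (simp add: w_def g_def right_diff_distrib[symmetric] abs_mult inner_diff_left abs_minus_commute)
    also have "\<bar>g t\<bar> = - g t" using g_le[OF t] by simp
    finally show "g' t \<le> - L * g t" by simp
  qed (use assms in auto)
  moreover have "g b = 0" using eq by (simp add: g_def)
  ultimately have "0 \<le> g a" by (simp add: zero_le_mult_iff)
  then have "g a = 0" using g_le[OF \<open>0 \<le> a\<close>] by simp
  then show ?thesis using sigma[OF i] by (auto simp: g_def right_diff_distrib[symmetric])
qed

lemma strong_comparison:
  assumes u: "\<And>t. 0 \<le> t \<Longrightarrow> (u has_vector_derivative F (u t)) (at t within {0..})"
    and v: "\<And>t. 0 \<le> t \<Longrightarrow> (v has_vector_derivative F (v t)) (at t within {0..})"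
    and uK: "\<And>t. 0 \<le> t \<Longrightarrow> u t \<in> cbox lo hi" and vK: "\<And>t. 0 \<le> t \<Longrightarrow> v t \<in> cbox lo hi"
    and irreducible: "\<And>x y i. x \<in> cbox lo hi \<Longrightarrow> y \<in> cbox lo hi \<Longrightarrow> sign_le \<sigma> x y \<Longrightarrow> x \<noteq> y \<Longrightarrow>
       i \<in> Basis \<Longrightarrow> x \<bullet> i = y \<bullet> i \<Longrightarrow> \<exists>j\<in>Basis. x \<bullet> j = y \<bullet> j \<and> F x \<bullet> j \<noteq> F y \<bullet> j"
    and init: "sign_le \<sigma> (u 0) (v 0)" "u 0 \<noteq> v 0" and "0 < T" and i: "i \<in> Basis"
  shows "(\<sigma> \<bullet> i) * (u T \<bullet> i) < (\<sigma> \<bullet> i) * (v T \<bullet> i)"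
proof (rule ccontr)
  assume neg: "\<not> ?thesis"
  have ord: "sign_le \<sigma> (u t) (v t)" if "0 \<le> t" for t
    using comparison[OF u v uK vK init(1) that] .
  have "(\<sigma> \<bullet> i) * (u T \<bullet> i) = (\<sigma> \<bullet> i) * (v T \<bullet> i)"
    using neg ord[of T] \<open>0 < T\<close> i by (force simp: sign_le_def)
  then have eqT: "u T \<bullet> i = v T \<bullet> i" using sigma[OF i] by auto
  define I where "I t = {j \<in> Basis. u t \<bullet> j = v t \<bullet> j}" for t
  have fin: "finite (I t)" for t by (simp add: I_def)
  have anti: "I b \<subseteq> I a" if "0 \<le> a" "a \<le> b" for a b
    using gap_persists[OF u v uK vK init(1) that] by (auto simp: I_def)
  \<comment> \<open>The zero set of the gap shrinks with time, so it is constant on some time interval before \<open>T\<close>.\<close>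
  obtain s where s: "0 < s" "s < T" "\<And>r. 0 < r \<Longrightarrow> r < T \<Longrightarrow> card (I s) \<le> card (I r)"
  proof -
    have "\<exists>s. (0 < s \<and> s < T) \<and> (\<forall>r. (0 < r \<and> r < T) \<longrightarrow> card (I s) \<le> card (I r))"
      by (rule ex_has_least_nat[of _ "T/2"]) (use \<open>0 < T\<close> in auto)
    then show ?thesis using that by blast
  qed
  have const: "I r = I s" if "s \<le> r" "r < T" for r
  proof (rule card_subset_eq[OF fin])
    show sub: "I r \<subseteq> I s" using anti[of s r] s that by simp
    show "card (I r) = card (I s)"
      using card_mono[OF fin sub] s(3)[of r] s(1) that by simp
  qed
  define r where "r = (s + T) / 2"
  have r: "s < r" "r < T" "0 < r" using s by (auto simp: r_def)
  have "u r \<noteq> v r"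
  proof
    assume "u r = v r"
    then have "I r = Basis" by (simp add: I_def)
    then have "I 0 = Basis" using anti[of 0 r] r by (auto simp: I_def)
    then have "u 0 = v 0" by (auto simp: I_def intro: euclidean_eqI)
    then show False using init by simp
  qed
  moreover have "u r \<bullet> i = v r \<bullet> i"
    using gap_persists[OF u v uK vK init(1) _ _ i eqT, of r] r by simp
  ultimately obtain j where j: "j \<in> Basis" "u r \<bullet> j = v r \<bullet> j" "F (u r) \<bullet> j \<noteq> F (v r) \<bullet> j"
    using irreducible[OF uK vK ord _ i] r by (metis less_eq_real_def)
  define g where "g t = 1 * (u t \<bullet> j) - 1 * (v t \<bullet> j)" for t
  have "(g has_real_derivative 1 * (F (u r) \<bullet> j) - 1 * (F (v r) \<bullet> j)) (at r within {0..})"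
    unfolding g_def using r by (intro DERIV_diff solution_component u v) auto
  moreover have "at r within {0..} = at r" using r by (intro at_within_interior) simp
  ultimately have d1: "DERIV g r :> F (u r) \<bullet> j - F (v r) \<bullet> j" by simp
  have "j \<in> I t" if "t \<in> {s<..<T}" for t
    using const[of r] const[of t] that r j by (auto simp: I_def)
  then have g0: "0 = g t" if "t \<in> {s<..<T}" for t
    using that by (auto simp: g_def I_def)
  have "DERIV g r :> 0"
    by (rule has_field_derivative_transform_within_open[OF DERIV_const open_greaterThanLessThan])
       (use r g0 in auto)
  then show False using DERIV_unique[OF d1] j(3) by fastforce
qed

end

section \<open>Monotonicity of the vector field\<close>

lemma quadratic_ratio_strict_antimono:
  fixes a0 a1 a2 d0 d1 d2 \<mu> \<nu> :: real
  assumes d: "0 < d0" "0 < d1" "0 < d2" and "0 \<le> \<mu>" "\<mu> < \<nu>"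
    and q: "a1 * d0 < a0 * d1" "a2 * d0 < a0 * d2" "a2 * d1 < a1 * d2"
  shows "(a0 + a1 * \<nu> + a2 * \<nu>\<^sup>2) / (d0 + d1 * \<nu> + d2 * \<nu>\<^sup>2)
       < (a0 + a1 * \<mu> + a2 * \<mu>\<^sup>2) / (d0 + d1 * \<mu> + d2 * \<mu>\<^sup>2)"
proof -
  have pos: "0 < d0 + d1 * x + d2 * x\<^sup>2" if "0 \<le> x" for x
    using d that by (intro add_pos_nonneg) auto
  have "0 < (a0 * d1 - a1 * d0) + (a0 * d2 - a2 * d0) * (\<mu> + \<nu>) + (a1 * d2 - a2 * d1) * (\<mu> * \<nu>)"
    using assms by (intro add_pos_nonneg mult_nonneg_nonneg) auto
  then have "0 < (\<nu> - \<mu>) * ((a0 * d1 - a1 * d0) + (a0 * d2 - a2 * d0) * (\<mu> + \<nu>) + (a1 * d2 - a2 * d1) * (\<mu> * \<nu>))"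
    using \<open>\<mu> < \<nu>\<close> by simp
  then have "(a0 + a1 * \<nu> + a2 * \<nu>\<^sup>2) * (d0 + d1 * \<mu> + d2 * \<mu>\<^sup>2)
      < (a0 + a1 * \<mu> + a2 * \<mu>\<^sup>2) * (d0 + d1 * \<nu> + d2 * \<nu>\<^sup>2)"
    by (simp add: algebra_simps power2_eq_square)
  then show ?thesis
    using pos[of \<mu>] pos[of \<nu>] assms by (simp add: divide_less_eq less_divide_eq mult.commute)
qed

lemma Nfun_quadratic_ratio:
  "Nfun k k1 k2 b b1 b2 c cm \<mu> =
     (k * (b1 * b2 + (b1 + b2) * cm + cm\<^sup>2) + (k * b2 * c + k1 * (c * (b2 + cm))) * \<mu> + (k2 * c\<^sup>2) * \<mu>\<^sup>2)
     / ((b1 * b2 + (b1 + b2) * cm + cm\<^sup>2) * b + ((b * b2 + b1 * b2 + b1 * cm) * c) * \<mu> + (b2 * c\<^sup>2) * \<mu>\<^sup>2)"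
  by (simp add: Nfun_def Let_def algebra_simps)

lemma Nfun_pos:
  assumes "0 < k" "0 < k1" "0 < k2" "0 < b" "0 < b1" "0 < b2" "0 < c" "0 < cm" "0 \<le> \<mu>"
  shows "0 < Nfun k k1 k2 b b1 b2 c cm \<mu>"
  unfolding Nfun_quadratic_ratio using assms
  by (intro divide_pos_pos add_pos_nonneg mult_pos_pos add_nonneg_pos mult_nonneg_nonneg) auto

lemma Nfun_strict_antimono:
  assumes "0 < k2" "k2 < k1" "k1 < k" "0 < b" "b < b1" "b1 < b2" "0 < c" "0 < cm" "0 \<le> \<mu>" "\<mu> < \<nu>"
  shows "Nfun k k1 k2 b b1 b2 c cm \<nu> < Nfun k k1 k2 b b1 b2 c cm \<mu>"
proof -
  define e1 where "e1 = b1 * b2 + (b1 + b2) * cm + cm\<^sup>2"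
  have pos: "0 < k1" "0 < k" "0 < b1" "0 < b2" using assms by auto
  have e1: "0 < e1" unfolding e1_def using assms pos by (intro add_pos_pos mult_pos_pos) auto
  show ?thesis
    unfolding Nfun_quadratic_ratio e1_def[symmetric]
  proof (rule quadratic_ratio_strict_antimono)
    have "k1 * b < k * b1" using assms pos by (intro mult_strict_mono) auto
    then have "0 < c * e1 * (b2 + cm) * (k * b1 - k1 * b)"
      using assms pos e1 by (intro mult_pos_pos) auto
    then show "(k * b2 * c + k1 * (c * (b2 + cm))) * (e1 * b) < k * e1 * ((b * b2 + b1 * b2 + b1 * cm) * c)"
      by (simp add: algebra_simps)
    have "k2 * b < k * b2" using assms pos by (intro mult_strict_mono) auto
    then have "0 < c\<^sup>2 * e1 * (k * b2 - k2 * b)"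
      using assms pos e1 by (intro mult_pos_pos) auto
    then show "k2 * c\<^sup>2 * (e1 * b) < k * e1 * (b2 * c\<^sup>2)"
      by (simp add: algebra_simps)
    have "k2 * b1 < k1 * b2" using assms pos by (intro mult_strict_mono) auto
    then have "0 < c^3 * (b2 * (k * b2 - k2 * b) + (b2 + cm) * (k1 * b2 - k2 * b1))"
      using assms pos \<open>k2 * b < k * b2\<close> by (intro mult_pos_pos add_pos_pos) auto
    then show "k2 * c\<^sup>2 * ((b * b2 + b1 * b2 + b1 * cm) * c) < (k * b2 * c + k1 * (c * (b2 + cm))) * (b2 * c\<^sup>2)"
      by (simp add: algebra_simps power2_eq_square power3_eq_cube)
  qed (use assms pos e1 in \<open>auto intro!: mult_pos_pos add_pos_pos\<close>)
qed

lemma hill_product_mono: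
  fixes C A B s s' z z' :: real
  assumes "0 < C" "0 < A" "0 < B" "0 < s" "s \<le> s'" "0 < z" "z \<le> z'"
  shows "C / ((s'\<^sup>2 + A) * (z'\<^sup>2 + B)) \<le> C / ((s\<^sup>2 + A) * (z\<^sup>2 + B))"
    and "s < s' \<or> z < z' \<Longrightarrow> C / ((s'\<^sup>2 + A) * (z'\<^sup>2 + B)) < C / ((s\<^sup>2 + A) * (z\<^sup>2 + B))"
proof -
  have le: "s\<^sup>2 + A \<le> s'\<^sup>2 + A" "z\<^sup>2 + B \<le> z'\<^sup>2 + B" using assms by (auto intro!: power_mono)
  have pos: "0 < s\<^sup>2 + A" "0 < z\<^sup>2 + B" "0 < s'\<^sup>2 + A" "0 < z'\<^sup>2 + B"
    using assms by (auto intro!: add_nonneg_pos)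
  show "C / ((s'\<^sup>2 + A) * (z'\<^sup>2 + B)) \<le> C / ((s\<^sup>2 + A) * (z\<^sup>2 + B))"
    using le pos assms by (intro divide_left_mono mult_mono mult_pos_pos) auto
  assume "s < s' \<or> z < z'"
  then have "(s\<^sup>2 + A) * (z\<^sup>2 + B) < (s'\<^sup>2 + A) * (z'\<^sup>2 + B)"
  proof
    assume "s < s'"
    then have "s\<^sup>2 + A < s'\<^sup>2 + A" using assms by (auto intro!: power_strict_mono)
    then show ?thesis using le pos by (intro mult_less_le_imp_less) auto
  next
    assume "z < z'"
    then have "z\<^sup>2 + B < z'\<^sup>2 + B" using assms by (auto intro!: power_strict_mono)
    then show ?thesis using le pos by (intro mult_le_less_imp_less) auto
  qed
  then show "C / ((s'\<^sup>2 + A) * (z'\<^sup>2 + B)) < C / ((s\<^sup>2 + A) * (z\<^sup>2 + B))"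
    using pos assms by (intro divide_strict_left_mono mult_pos_pos) auto
qed

lemma hill_increasing_mono:
  fixes A s s' :: real
  assumes "0 < A" "0 < s"
  shows "s \<le> s' \<Longrightarrow> s\<^sup>2 / (s\<^sup>2 + A) \<le> s'\<^sup>2 / (s'\<^sup>2 + A)"
    and "s < s' \<Longrightarrow> s\<^sup>2 / (s\<^sup>2 + A) < s'\<^sup>2 / (s'\<^sup>2 + A)"
proof -
  have pos: "0 < x\<^sup>2 + A" for x using assms by (auto intro!: add_nonneg_pos)
  have eq: "x\<^sup>2 / (x\<^sup>2 + A) = 1 - A / (x\<^sup>2 + A)" for x using pos[of x] by (simp add: field_simps)
  show "s\<^sup>2 / (s\<^sup>2 + A) \<le> s'\<^sup>2 / (s'\<^sup>2 + A)" if "s \<le> s'"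
    unfolding eq using that assms pos by (auto intro!: divide_left_mono power_mono mult_pos_pos)
  show "s\<^sup>2 / (s\<^sup>2 + A) < s'\<^sup>2 / (s'\<^sup>2 + A)" if "s < s'"
    unfolding eq using that assms pos by (auto intro!: divide_strict_left_mono power_strict_mono mult_pos_pos)
qed

definition order_signs :: state where "order_signs = (- 1, 1, - 1, 1)"

lemma Basis_state: "(Basis :: state set) = {(1, 0, 0, 0), (0, 1, 0, 0), (0, 0, 1, 0), (0, 0, 0, 1)}"
  by (auto simp: Basis_prod_def zero_prod_def)

lemma sign_le_order_signs:
  "sign_le order_signs (m, s, n, z) (m', s', n', z') \<longleftrightarrow> m' \<le> m \<and> s \<le> s' \<and> n' \<le> n \<and> z \<le> z'"
  by (simp add: sign_le_def order_signs_def Basis_state)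

context
  fixes p :: params
  assumes adm: "admissible p"
begin

lemma N_z_pos: "0 \<le> \<mu> \<Longrightarrow> 0 < N_z p \<mu>"
  and N_s_antimono: "0 \<le> \<mu> \<Longrightarrow> \<mu> < \<nu> \<Longrightarrow> N_s p \<nu> < N_s p \<mu>"
  and N_z_antimono: "0 \<le> \<mu> \<Longrightarrow> \<mu> < \<nu> \<Longrightarrow> N_z p \<nu> < N_z p \<mu>"
  using adm unfolding admissible_def N_s_def N_z_def
  by (auto intro!: Nfun_pos Nfun_strict_antimono)

lemma G_s_mono:
  assumes "0 < s" "0 < m'" "m' \<le> m"
  shows "gam_s p * E_S p * A_s p / (s\<^sup>2 + A_s p) * N_s p m \<le> gam_s p * E_S p * A_s p / (s\<^sup>2 + A_s p) * N_s p m'"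
      (is "?c * _ \<le> _")
    and "m' \<noteq> m \<Longrightarrow> gam_s p * E_S p * A_s p / (s\<^sup>2 + A_s p) * N_s p m
           < gam_s p * E_S p * A_s p / (s\<^sup>2 + A_s p) * N_s p m'"
proof -
  have pos: "0 < ?c"
    using adm assms unfolding admissible_def by (intro divide_pos_pos mult_pos_pos add_nonneg_pos) auto
  show lt: "?c * N_s p m < ?c * N_s p m'" if "m' \<noteq> m"
    by (rule mult_strict_left_mono[OF N_s_antimono pos]) (use assms that in auto)
  show "?c * N_s p m \<le> ?c * N_s p m'"
    using lt by (cases "m' = m") (simp_all only: order_refl less_imp_le not_False_eq_True)
qed

lemma G_z_mono:
  assumes "0 < s" "s \<le> s'" "0 < z" "0 < n'" "n' \<le> n"
  shows "gam_z p * E_Z p * s\<^sup>2 * z\<^sup>2 / ((s\<^sup>2 + A_s p) * (z\<^sup>2 + A_z p)) * N_z p n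
       \<le> gam_z p * E_Z p * s'\<^sup>2 * z\<^sup>2 / ((s'\<^sup>2 + A_s p) * (z\<^sup>2 + A_z p)) * N_z p n'" (is "?l \<le> ?r")
    and "s \<noteq> s' \<or> n \<noteq> n' \<Longrightarrow>
       gam_z p * E_Z p * s\<^sup>2 * z\<^sup>2 / ((s\<^sup>2 + A_s p) * (z\<^sup>2 + A_z p)) * N_z p n
       < gam_z p * E_Z p * s'\<^sup>2 * z\<^sup>2 / ((s'\<^sup>2 + A_s p) * (z\<^sup>2 + A_z p)) * N_z p n'"
proof -
  have A: "0 < A_s p" "0 < A_z p" "0 < gam_z p" "0 < E_Z p" using adm by (auto simp: admissible_def)
  define c where "c = gam_z p * E_Z p * (z\<^sup>2 / (z\<^sup>2 + A_z p))"
  define h where "h s = s\<^sup>2 / (s\<^sup>2 + A_s p)" for s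
  have c: "0 < c" unfolding c_def using A assms by (intro mult_pos_pos divide_pos_pos add_nonneg_pos) auto
  have h: "0 < h x" if "0 < x" for x
    unfolding h_def using A that by (intro divide_pos_pos add_nonneg_pos) auto
  have hle: "h s \<le> h s'" and hlt: "s < s' \<Longrightarrow> h s < h s'"
    unfolding h_def using hill_increasing_mono[of "A_s p" s s'] A assms by auto
  have Nle: "N_z p n \<le> N_z p n'" and Nlt: "n \<noteq> n' \<Longrightarrow> N_z p n < N_z p n'"
    using N_z_antimono[of n' n] assms by (cases "n = n'"; force)+
  have Np: "0 < N_z p n" "0 < N_z p n'" using N_z_pos assms by auto
  have eq: "gam_z p * E_Z p * x\<^sup>2 * z\<^sup>2 / ((x\<^sup>2 + A_s p) * (z\<^sup>2 + A_z p)) * N_z p y = c * (h x * N_z p y)" for x y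
    by (simp add: c_def h_def mult_ac)
  show "?l \<le> ?r"
    unfolding eq using c hle Nle h[of s] h[of s'] Np assms
    by (intro mult_left_mono mult_mono) (auto intro: less_imp_le)
  assume "s \<noteq> s' \<or> n \<noteq> n'"
  then have "h s * N_z p n < h s' * N_z p n'"
  proof
    assume "s \<noteq> s'"
    then show ?thesis using hlt Nle Np h[of s] assms by (intro mult_less_le_imp_less) auto
  next
    assume "n \<noteq> n'"
    then show ?thesis using hle Nlt Np h[of s] assms by (intro mult_le_less_imp_less) auto
  qed
  then show "?l < ?r" unfolding eq using c by simp
qed

lemma G_components:
  "G p (m, s, n, z) \<bullet> (1, 0, 0, 0) = b34 p * E34 p * A_s p * A_z p / ((s\<^sup>2 + A_s p) * (z\<^sup>2 + A_z p)) - bm34 p * m"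
  "G p (m, s, n, z) \<bullet> (0, 1, 0, 0) = gam_s p * E_S p * A_s p / (s\<^sup>2 + A_s p) * N_s p m - km_s p * s"
  "G p (m, s, n, z) \<bullet> (0, 0, 1, 0) = b200 p * E200 p * A_s p * A_z p / ((s\<^sup>2 + A_s p) * (z\<^sup>2 + A_z p)) - bm200 p * n"
  "G p (m, s, n, z) \<bullet> (0, 0, 0, 1) = delta_z p
     + gam_z p * E_Z p * s\<^sup>2 * z\<^sup>2 / ((s\<^sup>2 + A_s p) * (z\<^sup>2 + A_z p)) * N_z p n - km_z p * z"
  by (simp_all add: G_def)

lemma G_quasimonotone:
  assumes "x \<in> orthant" "y \<in> orthant" "sign_le order_signs x y" "i \<in> Basis" "x \<bullet> i = y \<bullet> i"
  shows "(order_signs \<bullet> i) * (G p x \<bullet> i) \<le> (order_signs \<bullet> i) * (G p y \<bullet> i)"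
proof -
  obtain m s n z where x: "x = (m, s, n, z)" by (cases x)
  obtain m' s' n' z' where y: "y = (m', s', n', z')" by (cases y)
  have pos: "0 < m" "0 < s" "0 < n" "0 < z" "0 < m'" "0 < s'" "0 < n'" "0 < z'"
    using assms by (auto simp: x y orthant_def)
  have le: "m' \<le> m" "s \<le> s'" "n' \<le> n" "z \<le> z'"
    using assms(3) by (auto simp: x y sign_le_order_signs)
  have par: "0 < A_s p" "0 < A_z p" "0 < b34 p * E34 p * A_s p * A_z p" "0 < b200 p * E200 p * A_s p * A_z p"
    using adm by (auto simp: admissible_def)
  show ?thesis
    using assms(4,5) hill_product_mono(1)[OF par(3,1,2) pos(2) le(2) pos(4) le(4)]
      hill_product_mono(1)[OF par(4,1,2) pos(2) le(2) pos(4) le(4)]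
      G_s_mono(1)[OF pos(2,5) le(1)] G_z_mono(1)[OF pos(2) le(2) pos(4,7) le(3)]
    unfolding x y Basis_state by (auto simp: G_def order_signs_def)
qed

lemma G_irreducible:
  assumes "x \<in> orthant" "y \<in> orthant" "sign_le order_signs x y" "x \<noteq> y" "i \<in> Basis" "x \<bullet> i = y \<bullet> i"
  shows "\<exists>j\<in>Basis. x \<bullet> j = y \<bullet> j \<and> G p x \<bullet> j \<noteq> G p y \<bullet> j"
proof -
  obtain m s n z where x: "x = (m, s, n, z)" by (cases x)
  obtain m' s' n' z' where y: "y = (m', s', n', z')" by (cases y)
  have pos: "0 < m" "0 < s" "0 < n" "0 < z" "0 < m'" "0 < s'" "0 < n'" "0 < z'"
    using assms by (auto simp: x y orthant_def)
  have le: "m' \<le> m" "s \<le> s'" "n' \<le> n" "z \<le> z'"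
    using assms(3) by (auto simp: x y sign_le_order_signs)
  have par: "0 < A_s p" "0 < A_z p" "0 < b34 p * E34 p * A_s p * A_z p" "0 < b200 p * E200 p * A_s p * A_z p"
    using adm by (auto simp: admissible_def)
  have m: "G p x \<bullet> (1, 0, 0, 0) \<noteq> G p y \<bullet> (1, 0, 0, 0)" if "m = m'" "s \<noteq> s' \<or> z \<noteq> z'"
  proof -
    have "s < s' \<or> z < z'" using that le by auto
    from hill_product_mono(2)[OF par(3,1,2) pos(2) le(2) pos(4) le(4) this]
    show ?thesis unfolding x y G_components that(1) by linarith
  qed
  have s: "G p x \<bullet> (0, 1, 0, 0) \<noteq> G p y \<bullet> (0, 1, 0, 0)" if "s = s'" "m \<noteq> m'"
  proof -
    have "m' \<noteq> m" using that by simp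
    from G_s_mono(2)[OF pos(2,5) le(1) this]
    show ?thesis unfolding x y G_components that(1) by linarith
  qed
  have n: "G p x \<bullet> (0, 0, 1, 0) \<noteq> G p y \<bullet> (0, 0, 1, 0)" if "n = n'" "s \<noteq> s' \<or> z \<noteq> z'"
  proof -
    have "s < s' \<or> z < z'" using that le by auto
    from hill_product_mono(2)[OF par(4,1,2) pos(2) le(2) pos(4) le(4) this]
    show ?thesis unfolding x y G_components that(1) by linarith
  qed
  have z: "G p x \<bullet> (0, 0, 0, 1) \<noteq> G p y \<bullet> (0, 0, 0, 1)" if "z = z'" "s \<noteq> s' \<or> n \<noteq> n'"
  proof -
    have "s \<noteq> s' \<or> n \<noteq> n'" using that by simp
    from G_z_mono(2)[OF pos(2) le(2) pos(4,7) le(3) this]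
    show ?thesis unfolding x y G_components that(1) by linarith
  qed
  have ne: "m \<noteq> m' \<or> s \<noteq> s' \<or> n \<noteq> n' \<or> z \<noteq> z'" using assms(4) by (simp add: x y)
  have eq: "m = m' \<or> s = s' \<or> n = n' \<or> z = z'"
    using assms(5,6) by (auto simp: x y Basis_state)
  have "\<exists>j\<in>{(1, 0, 0, 0), (0, 1, 0, 0), (0, 0, 1, 0), (0, 0, 0, 1)}.
      (m, s, n, z) \<bullet> j = (m', s', n', z') \<bullet> j \<and> G p x \<bullet> j \<noteq> G p y \<bullet> j"
    using m s n z ne eq by (simp add: inner_Pair) blast
  then show ?thesis unfolding Basis_state x y .
qed

end

section \<open>Lipschitz continuity on boxes\<close>

definition lipschitz_bounded :: "'a::metric_space set \<Rightarrow> ('a \<Rightarrow> real) \<Rightarrow> bool" where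
  "lipschitz_bounded S f \<longleftrightarrow> (\<exists>L. L-lipschitz_on S f) \<and> (\<exists>M. \<forall>x\<in>S. \<bar>f x\<bar> \<le> M)"

lemma lipschitz_bounded_const: "lipschitz_bounded S (\<lambda>x. c)"
  unfolding lipschitz_bounded_def using lipschitz_on_constant by blast

lemma lipschitz_bounded_add:
  assumes "lipschitz_bounded S f" "lipschitz_bounded S g"
  shows "lipschitz_bounded S (\<lambda>x. f x + g x)"
proof -
  obtain L M L' M' where "L-lipschitz_on S f" "L'-lipschitz_on S g"
    "\<forall>x\<in>S. \<bar>f x\<bar> \<le> M" "\<forall>x\<in>S. \<bar>g x\<bar> \<le> M'"
    using assms unfolding lipschitz_bounded_def by blast
  then have "(L + L')-lipschitz_on S (\<lambda>x. f x + g x)" "\<forall>x\<in>S. \<bar>f x + g x\<bar> \<le> M + M'"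
    by (auto intro: lipschitz_on_add) (meson abs_triangle_ineq add_mono order_trans)
  then show ?thesis unfolding lipschitz_bounded_def by blast
qed

lemma lipschitz_bounded_mult:
  assumes "lipschitz_bounded S f" "lipschitz_bounded S g"
  shows "lipschitz_bounded S (\<lambda>x. f x * g x)"
proof -
  obtain L M L' M' where f: "L-lipschitz_on S f" "\<And>x. x \<in> S \<Longrightarrow> \<bar>f x\<bar> \<le> M"
    and g: "L'-lipschitz_on S g" "\<And>x. x \<in> S \<Longrightarrow> \<bar>g x\<bar> \<le> M'"
    using assms unfolding lipschitz_bounded_def by blast
  have L: "0 \<le> L" "0 \<le> L'" using f g lipschitz_on_nonneg by blast+
  have "(\<bar>M\<bar> * L' + \<bar>M'\<bar> * L)-lipschitz_on S (\<lambda>x. f x * g x)"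
  proof (rule lipschitz_onI)
    fix x y assume xy: "x \<in> S" "y \<in> S"
    have "\<bar>f x * g x - f y * g y\<bar> = \<bar>f x * (g x - g y) + g y * (f x - f y)\<bar>"
      by (simp add: algebra_simps)
    also have "\<dots> \<le> \<bar>f x\<bar> * \<bar>g x - g y\<bar> + \<bar>g y\<bar> * \<bar>f x - f y\<bar>"
      by (metis abs_mult abs_triangle_ineq)
    also have "\<dots> \<le> \<bar>M\<bar> * (L' * dist x y) + \<bar>M'\<bar> * (L * dist x y)"
      using f(2)[OF xy(1)] g(2)[OF xy(2)] lipschitz_onD[OF f(1) xy] lipschitz_onD[OF g(1) xy] L
      by (intro add_mono mult_mono) (auto simp: dist_real_def)
    finally show "dist (f x * g x) (f y * g y) \<le> (\<bar>M\<bar> * L' + \<bar>M'\<bar> * L) * dist x y"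
      by (simp add: dist_real_def algebra_simps)
  qed (use L in auto)
  moreover have "\<bar>f x * g x\<bar> \<le> \<bar>M\<bar> * \<bar>M'\<bar>" if "x \<in> S" for x
    using f(2)[OF that] g(2)[OF that] by (auto simp: abs_mult intro!: mult_mono)
  ultimately show ?thesis unfolding lipschitz_bounded_def by blast
qed

lemma lipschitz_bounded_diff:
  assumes "lipschitz_bounded S f" "lipschitz_bounded S g"
  shows "lipschitz_bounded S (\<lambda>x. f x - g x)"
  using lipschitz_bounded_add[OF assms(1) lipschitz_bounded_mult[OF lipschitz_bounded_const[of S "- 1"] assms(2)]]
  by simp

lemma lipschitz_bounded_power2:
  "lipschitz_bounded S f \<Longrightarrow> lipschitz_bounded S (\<lambda>x. (f x)\<^sup>2)"
  unfolding power2_eq_square by (rule lipschitz_bounded_mult)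

lemma lipschitz_bounded_divide:
  assumes "lipschitz_bounded S f" "lipschitz_bounded S g" "0 < c" and c: "\<And>x. x \<in> S \<Longrightarrow> c \<le> g x"
  shows "lipschitz_bounded S (\<lambda>x. f x / g x)"
proof -
  obtain L where g: "L-lipschitz_on S g"
    using assms unfolding lipschitz_bounded_def by blast
  have L: "0 \<le> L" using g lipschitz_on_nonneg by blast
  have "(L / (c * c))-lipschitz_on S (\<lambda>x. 1 / g x)"
  proof (rule lipschitz_onI)
    fix x y assume xy: "x \<in> S" "y \<in> S"
    have pos: "0 < g x" "0 < g y" using c xy \<open>0 < c\<close> by force+
    have "\<bar>1 / g x - 1 / g y\<bar> = \<bar>g x - g y\<bar> / (g x * g y)"
      using pos by (simp add: divide_simps abs_divide abs_minus_commute)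
    also have "\<dots> \<le> (L * dist x y) / (c * c)"
      using pos c[OF xy(1)] c[OF xy(2)] \<open>0 < c\<close> lipschitz_onD[OF g xy]
      by (intro frac_le mult_mono) (auto simp: dist_real_def intro: order_trans)
    finally show "dist (1 / g x) (1 / g y) \<le> L / (c * c) * dist x y"
      by (simp add: dist_real_def)
  qed (use L \<open>0 < c\<close> in auto)
  moreover have "\<bar>1 / g x\<bar> \<le> 1 / c" if "x \<in> S" for x
    using c[OF that] \<open>0 < c\<close> by (simp add: frac_le)
  ultimately have "lipschitz_bounded S (\<lambda>x. 1 / g x)" unfolding lipschitz_bounded_def by blast
  then show ?thesis using lipschitz_bounded_mult[OF assms(1)] by fastforce
qed

lemma lipschitz_bounded_inner:
  fixes S :: "'a::euclidean_space set"
  assumes "bounded S"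
  shows "lipschitz_bounded S (\<lambda>x. x \<bullet> i)"
proof -
  obtain M where M: "\<And>x. x \<in> S \<Longrightarrow> norm x \<le> M" using assms bounded_iff by blast
  have "(norm i)-lipschitz_on S (\<lambda>x. x \<bullet> i)"
  proof (rule lipschitz_onI)
    show "dist (x \<bullet> i) (y \<bullet> i) \<le> norm i * dist x y" for x y
      using Cauchy_Schwarz_ineq2[of "x - y" i]
      by (simp add: dist_real_def dist_norm inner_diff_left mult.commute)
  qed simp
  moreover have "\<bar>x \<bullet> i\<bar> \<le> M * norm i" if "x \<in> S" for x
    using Cauchy_Schwarz_ineq2[of x i] mult_right_mono[OF M[OF that], of "norm i"] by simp
  ultimately show ?thesis unfolding lipschitz_bounded_def by blast
qed

lemma lipschitz_bounded_Nfun: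
  assumes f: "lipschitz_bounded S f" and nn: "\<And>x. x \<in> S \<Longrightarrow> 0 \<le> f x"
    and pos: "0 < b" "0 < b1" "0 < b2" "0 < c" "0 < cm"
  shows "lipschitz_bounded S (\<lambda>x. Nfun k k1 k2 b b1 b2 c cm (f x))"
  unfolding Nfun_quadratic_ratio
proof (rule lipschitz_bounded_divide)
  show "0 < (b1 * b2 + (b1 + b2) * cm + cm\<^sup>2) * b"
    using pos by (intro mult_pos_pos add_pos_pos) auto
  show "(b1 * b2 + (b1 + b2) * cm + cm\<^sup>2) * b \<le> (b1 * b2 + (b1 + b2) * cm + cm\<^sup>2) * b
      + ((b * b2 + b1 * b2 + b1 * cm) * c) * f x + (b2 * c\<^sup>2) * (f x)\<^sup>2" if "x \<in> S" for x
  proof -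
    have "0 \<le> ((b * b2 + b1 * b2 + b1 * cm) * c) * f x" "0 \<le> (b2 * c\<^sup>2) * (f x)\<^sup>2"
      using pos nn[OF that] by auto
    then show ?thesis by linarith
  qed
qed (intro lipschitz_bounded_add lipschitz_bounded_mult lipschitz_bounded_const lipschitz_bounded_power2 f)+

definition state_box :: "nat \<Rightarrow> state set" where
  "state_box m = cbox (inverse (real (Suc m)) *\<^sub>R One) (real (Suc m) *\<^sub>R One)"

lemma mem_state_box:
  "x \<in> state_box m \<longleftrightarrow> (\<forall>i\<in>Basis. inverse (real (Suc m)) \<le> x \<bullet> i \<and> x \<bullet> i \<le> real (Suc m))"
  by (simp add: state_box_def mem_box)

lemma state_box_mono: "m \<le> n \<Longrightarrow> state_box m \<subseteq> state_box n"
proof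
  fix x assume "m \<le> n" "x \<in> state_box m"
  moreover have "inverse (real (Suc n)) \<le> inverse (real (Suc m))" "real (Suc m) \<le> real (Suc n)"
    using \<open>m \<le> n\<close> by (auto intro: le_imp_inverse_le)
  ultimately show "x \<in> state_box n" unfolding mem_state_box by (meson order_trans)
qed

lemma mem_orthant_iff: "x \<in> orthant \<longleftrightarrow> (\<forall>i\<in>Basis. 0 < x \<bullet> i)"
  by (cases x) (simp add: orthant_def Basis_state)

lemma state_box_subset_orthant: "state_box m \<subseteq> orthant"
  unfolding subset_iff mem_orthant_iff mem_state_box
  by (metis inverse_positive_iff_positive less_le_trans of_nat_0_less_iff zero_less_Suc)

lemma compact_subset_state_box:
  assumes "compact C" "C \<subseteq> orthant"
  obtains m where "C \<subseteq> state_box m"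
proof -
  define U where "U m = box (inverse (real (Suc m)) *\<^sub>R One) (real (Suc m) *\<^sub>R One :: state)" for m
  have U: "x \<in> U m \<longleftrightarrow> (\<forall>i\<in>Basis. inverse (real (Suc m)) < x \<bullet> i \<and> x \<bullet> i < real (Suc m))" for x m
    by (simp add: U_def mem_box)
  have "\<exists>m. x \<in> U m" if "x \<in> C" for x
  proof -
    have "\<exists>m::nat. inverse (x \<bullet> i) + x \<bullet> i < real m" for i by (rule reals_Archimedean2)
    then obtain f :: "state \<Rightarrow> nat" where f: "\<And>i. inverse (x \<bullet> i) + x \<bullet> i < real (f i)" by metis
    define m where "m = Max (f ` Basis)"
    have "inverse (real (Suc m)) < x \<bullet> i \<and> x \<bullet> i < real (Suc m)" if i: "i \<in> Basis" for i
    proof -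
      have xi: "0 < x \<bullet> i" using \<open>x \<in> C\<close> assms(2) i by (auto simp: mem_orthant_iff)
      have "real (f i) \<le> real m" unfolding m_def using i by simp
      then have "inverse (x \<bullet> i) < real (Suc m)" "x \<bullet> i < real (Suc m)"
        using f[of i] xi positive_imp_inverse_positive[OF xi] by linarith+
      then show ?thesis using xi by (metis inverse_inverse_eq inverse_less_imp_less less_imp_inverse_less
            positive_imp_inverse_positive)
    qed
    then show ?thesis using U by blast
  qed
  then have cover: "C \<subseteq> (\<Union>m\<in>UNIV. U m)" by blast
  have "open (U m)" for m unfolding U_def by (rule open_box)
  then obtain D where D: "finite D" "C \<subseteq> (\<Union>m\<in>D. U m)"
    by (rule compactE_image[OF assms(1) _ cover])
  have "U m \<subseteq> state_box (Max D)" if "m \<in> D" for m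
  proof -
    have "U m \<subseteq> state_box m" unfolding U_def state_box_def by (rule box_subset_cbox)
    then show ?thesis using state_box_mono[of m "Max D"] Max_ge[OF D(1) that] by blast
  qed
  then show ?thesis using D that[of "Max D"] by blast
qed

section \<open>The flow of the reduced system\<close>

context
  fixes p :: params
  assumes adm: "admissible p"
begin

lemma G_lipschitz_on_state_box: "\<exists>L. L-lipschitz_on (state_box m) (G p)"
proof -
  let ?S = "state_box m"
  have bdd: "bounded ?S" by (simp add: state_box_def)
  note coord = lipschitz_bounded_inner[OF bdd]
  have c1: "lipschitz_bounded ?S fst" using coord[of "(1, 0, 0, 0)"] by (simp add: inner_prod_def)
  have c2: "lipschitz_bounded ?S (\<lambda>x. fst (snd x))" using coord[of "(0, 1, 0, 0)"] by (simp add: inner_prod_def)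
  have c3: "lipschitz_bounded ?S (\<lambda>x. fst (snd (snd x)))" using coord[of "(0, 0, 1, 0)"] by (simp add: inner_prod_def)
  have c4: "lipschitz_bounded ?S (\<lambda>x. snd (snd (snd x)))" using coord[of "(0, 0, 0, 1)"] by (simp add: inner_prod_def)
  have nn: "0 \<le> fst x" "0 \<le> fst (snd (snd x))" if "x \<in> ?S" for x
    using that state_box_subset_orthant[of m] by (auto simp: orthant_def)
  have A: "0 < A_s p" "0 < A_z p" using adm by (auto simp: admissible_def)
  have Ns: "lipschitz_bounded ?S (\<lambda>x. N_s p (fst x))"
    unfolding N_s_def using adm
    by (intro lipschitz_bounded_Nfun c1 nn) (auto simp: admissible_def)
  have Nz: "lipschitz_bounded ?S (\<lambda>x. N_z p (fst (snd (snd x))))"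
    unfolding N_z_def using adm
    by (intro lipschitz_bounded_Nfun c3 nn) (auto simp: admissible_def)
  note lb = lipschitz_bounded_add lipschitz_bounded_diff lipschitz_bounded_mult lipschitz_bounded_const
    lipschitz_bounded_power2 c1 c2 c3 c4 Ns Nz
  have ge: "A_s p \<le> a\<^sup>2 + A_s p" "A_s p * A_z p \<le> (a\<^sup>2 + A_s p) * (b\<^sup>2 + A_z p)" for a b
    using A by (auto intro!: mult_mono)
  have AA: "0 < A_s p * A_z p" using A by simp
  have g1: "lipschitz_bounded ?S (\<lambda>x. b34 p * E34 p * A_s p * A_z p
      / (((fst (snd x))\<^sup>2 + A_s p) * ((snd (snd (snd x)))\<^sup>2 + A_z p)) - bm34 p * fst x)"
    by (rule lipschitz_bounded_diff, rule lipschitz_bounded_divide[OF _ _ AA ge(2)]) (intro lb)+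
  have g2: "lipschitz_bounded ?S (\<lambda>x. gam_s p * E_S p * A_s p / ((fst (snd x))\<^sup>2 + A_s p) * N_s p (fst x)
      - km_s p * fst (snd x))"
    by (rule lipschitz_bounded_diff, rule lipschitz_bounded_mult,
        rule lipschitz_bounded_divide[OF _ _ A(1) ge(1)]) (intro lb)+
  have g3: "lipschitz_bounded ?S (\<lambda>x. b200 p * E200 p * A_s p * A_z p
      / (((fst (snd x))\<^sup>2 + A_s p) * ((snd (snd (snd x)))\<^sup>2 + A_z p)) - bm200 p * fst (snd (snd x)))"
    by (rule lipschitz_bounded_diff, rule lipschitz_bounded_divide[OF _ _ AA ge(2)]) (intro lb)+
  have g4: "lipschitz_bounded ?S (\<lambda>x. delta_z p + gam_z p * E_Z p * (fst (snd x))\<^sup>2 * (snd (snd (snd x)))\<^sup>2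
      / (((fst (snd x))\<^sup>2 + A_s p) * ((snd (snd (snd x)))\<^sup>2 + A_z p)) * N_z p (fst (snd (snd x)))
      - km_z p * snd (snd (snd x)))"
    by (rule lipschitz_bounded_diff, rule lipschitz_bounded_add, rule lipschitz_bounded_const,
        rule lipschitz_bounded_mult, rule lipschitz_bounded_divide[OF _ _ AA ge(2)]) (intro lb)+
  have G: "G p = (\<lambda>x.
     (b34 p * E34 p * A_s p * A_z p
        / (((fst (snd x))\<^sup>2 + A_s p) * ((snd (snd (snd x)))\<^sup>2 + A_z p)) - bm34 p * fst x,
      gam_s p * E_S p * A_s p / ((fst (snd x))\<^sup>2 + A_s p) * N_s p (fst x) - km_s p * fst (snd x),
      b200 p * E200 p * A_s p * A_z p
        / (((fst (snd x))\<^sup>2 + A_s p) * ((snd (snd (snd x)))\<^sup>2 + A_z p)) - bm200 p * fst (snd (snd x)),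
      delta_z p + gam_z p * E_Z p * (fst (snd x))\<^sup>2 * (snd (snd (snd x)))\<^sup>2
        / (((fst (snd x))\<^sup>2 + A_s p) * ((snd (snd (snd x)))\<^sup>2 + A_z p)) * N_z p (fst (snd (snd x)))
        - km_z p * snd (snd (snd x))))"
    by (rule ext) (simp add: G_def split_beta)
  obtain L1 L2 L3 L4 where l:
    "L1-lipschitz_on ?S (\<lambda>x. b34 p * E34 p * A_s p * A_z p
      / (((fst (snd x))\<^sup>2 + A_s p) * ((snd (snd (snd x)))\<^sup>2 + A_z p)) - bm34 p * fst x)"
    "L2-lipschitz_on ?S (\<lambda>x. gam_s p * E_S p * A_s p / ((fst (snd x))\<^sup>2 + A_s p) * N_s p (fst x)
      - km_s p * fst (snd x))"
    "L3-lipschitz_on ?S (\<lambda>x. b200 p * E200 p * A_s p * A_z p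
      / (((fst (snd x))\<^sup>2 + A_s p) * ((snd (snd (snd x)))\<^sup>2 + A_z p)) - bm200 p * fst (snd (snd x)))"
    "L4-lipschitz_on ?S (\<lambda>x. delta_z p + gam_z p * E_Z p * (fst (snd x))\<^sup>2 * (snd (snd (snd x)))\<^sup>2
      / (((fst (snd x))\<^sup>2 + A_s p) * ((snd (snd (snd x)))\<^sup>2 + A_z p)) * N_z p (fst (snd (snd x)))
      - km_z p * snd (snd (snd x)))"
    using g1 g2 g3 g4 unfolding lipschitz_bounded_def by blast
  show ?thesis
    unfolding G
    using lipschitz_on_Pair[OF l(1) lipschitz_on_Pair[OF l(2) lipschitz_on_Pair[OF l(3,4)]]] by blast
qed

lemma cooperative_G:
  obtains L where "cooperative_field order_signs (inverse (real (Suc m)) *\<^sub>R One) (real (Suc m) *\<^sub>R One) (G p) L"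
proof -
  obtain L where L: "L-lipschitz_on (state_box m) (G p)" using G_lipschitz_on_state_box by blast
  have "cooperative_field order_signs (inverse (real (Suc m)) *\<^sub>R One) (real (Suc m) *\<^sub>R One) (G p) L"
  proof
    show "\<bar>order_signs \<bullet> i\<bar> = 1" if "i \<in> Basis" for i
      using that by (auto simp: order_signs_def Basis_state)
    show "L-lipschitz_on (cbox (inverse (real (Suc m)) *\<^sub>R One) (real (Suc m) *\<^sub>R One)) (G p)"
      using L by (simp add: state_box_def)
  next
    fix x y i :: state
    assume "x \<in> cbox (inverse (real (Suc m)) *\<^sub>R One) (real (Suc m) *\<^sub>R One)"
      "y \<in> cbox (inverse (real (Suc m)) *\<^sub>R One) (real (Suc m) *\<^sub>R One)"
      "sign_le order_signs x y" "i \<in> Basis" "x \<bullet> i = y \<bullet> i"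
    then show "(order_signs \<bullet> i) * (G p x \<bullet> i) \<le> (order_signs \<bullet> i) * (G p y \<bullet> i)"
      using G_quasimonotone[OF adm] state_box_subset_orthant[of m] unfolding state_box_def by blast
  qed
  then show ?thesis using that by blast
qed

lemma fwd_solution_continuous: "fwd_solution p x0 u \<Longrightarrow> continuous_on {0..} u"
  unfolding fwd_solution_def continuous_on_eq_continuous_within
  using has_vector_derivative_continuous by blast

lemma fwd_solution_unique:
  assumes u: "fwd_solution p x0 u" and v: "fwd_solution p x0 v" and "0 \<le> t"
  shows "u t = v t"
proof -
  have "compact (u ` {0..t} \<union> v ` {0..t})"
    using fwd_solution_continuous[OF u] fwd_solution_continuous[OF v]
    by (intro compact_Un compact_continuous_image) (auto intro: continuous_on_subset)
  moreover have "u ` {0..t} \<union> v ` {0..t} \<subseteq> orthant"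
    using u v by (auto simp: fwd_solution_def)
  ultimately obtain m where m: "u ` {0..t} \<union> v ` {0..t} \<subseteq> state_box m"
    using compact_subset_state_box by blast
  obtain L where L: "L-lipschitz_on (state_box m) (G p)" using G_lipschitz_on_state_box by blast
  have "dist (u t) (v t) \<le> exp (L * t) * dist (u 0) (v 0)"
    by (rule solutions_dist_bound[OF L \<open>0 \<le> t\<close>]) (use u v m in \<open>auto simp: fwd_solution_def\<close>)
  then show ?thesis using u v by (simp add: fwd_solution_def)
qed

text \<open>Meaningless at points without a forward solution.\<close>

definition flow :: "real \<Rightarrow> state \<Rightarrow> state" where
  "flow t x0 = (SOME u. fwd_solution p x0 u) t"

text \<open>Compact, forward invariant, and exhausting \<open>Wc p\<close>: working inside one such set at a time needs no
  existence theorem for the initial value problem.\<close>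

definition trapped :: "nat \<Rightarrow> state set" where
  "trapped m = {x0. \<exists>u. fwd_solution p x0 u \<and> (\<forall>t\<ge>0. u t \<in> state_box m)}"

lemma flow_eq: "fwd_solution p x0 u \<Longrightarrow> 0 \<le> t \<Longrightarrow> flow t x0 = u t"
  unfolding flow_def using fwd_solution_unique[OF someI[of "fwd_solution p x0" u]] by blast

lemma Wc_subset_trapped: "Wc p \<subseteq> (\<Union>m. trapped m)"
proof
  fix x0 assume "x0 \<in> Wc p"
  then obtain u where u: "fwd_solution p x0 u" "compact (closure (u ` {0..}))" "closure (u ` {0..}) \<subseteq> orthant"
    by (auto simp: Wc_def)
  then obtain m where "closure (u ` {0..}) \<subseteq> state_box m" using compact_subset_state_box by blast
  then have "\<forall>t\<ge>0. u t \<in> state_box m" using closure_subset[of "u ` {0..}"] by auto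
  then show "x0 \<in> (\<Union>m. trapped m)" using u(1) by (auto simp: trapped_def)
qed

lemma flow_solution:
  assumes "x0 \<in> trapped m"
  shows "fwd_solution p x0 (\<lambda>t. flow t x0)" and "0 \<le> t \<Longrightarrow> flow t x0 \<in> state_box m"
proof -
  obtain u where u: "fwd_solution p x0 u" "\<And>t. 0 \<le> t \<Longrightarrow> u t \<in> state_box m"
    using assms by (auto simp: trapped_def)
  have eq: "flow t x0 = u t" if "0 \<le> t" for t using flow_eq[OF u(1) that] .
  show "0 \<le> t \<Longrightarrow> flow t x0 \<in> state_box m" using eq u(2) by simp
  have "((\<lambda>t. flow t x0) has_vector_derivative G p (flow t x0)) (at t within {0..})" if "0 \<le> t" for t
    using u(1) that eq
    by (intro has_vector_derivative_transform[of t "{0..}" "\<lambda>t. flow t x0" u]) (auto simp: fwd_solution_def)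
  then show "fwd_solution p x0 (\<lambda>t. flow t x0)"
    using u(1) eq by (simp add: fwd_solution_def)
qed

lemma flow_derivative:
  "x0 \<in> trapped m \<Longrightarrow> 0 \<le> t \<Longrightarrow>
    ((\<lambda>t. flow t x0) has_vector_derivative G p (flow t x0)) (at t within {0..})"
  using flow_solution(1) unfolding fwd_solution_def by blast

lemma flow_zero: "x0 \<in> trapped m \<Longrightarrow> flow 0 x0 = x0"
  using flow_solution(1) unfolding fwd_solution_def by blast

lemma fwd_solution_shift:
  assumes "fwd_solution p x0 u" "0 \<le> s"
  shows "fwd_solution p (u s) (\<lambda>t. u (t + s))"
proof -
  have "((\<lambda>t. u (t + s)) has_vector_derivative G p (u (t + s))) (at t within {0..})" if t: "0 \<le> t" for t
  proof -
    have "((\<lambda>t. t + s) has_vector_derivative 1) (at t within {0..})"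
      by (auto intro!: derivative_eq_intros)
    moreover have "(u has_vector_derivative G p (u (t + s))) (at (t + s) within (\<lambda>t. t + s) ` {0..})"
      by (rule has_vector_derivative_within_subset[of _ _ _ "{0..}"])
         (use assms t in \<open>auto simp: fwd_solution_def\<close>)
    ultimately show ?thesis
      using vector_diff_chain_within[of "\<lambda>t. t + s" 1 t "{0..}" u "G p (u (t + s))"] by (simp add: comp_def)
  qed
  then show ?thesis using assms by (simp add: fwd_solution_def)
qed

lemma flow_semigroup:
  assumes "x0 \<in> trapped m" "0 \<le> s"
  shows "flow s x0 \<in> trapped m" and "0 \<le> t \<Longrightarrow> flow (t + s) x0 = flow t (flow s x0)"
proof -
  have sol: "fwd_solution p (flow s x0) (\<lambda>t. flow (t + s) x0)"
    using fwd_solution_shift[OF flow_solution(1)[OF assms(1)] assms(2)] .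
  show "flow s x0 \<in> trapped m"
    unfolding trapped_def using sol flow_solution(2)[OF assms(1)] assms(2) by force
  show "flow (t + s) x0 = flow t (flow s x0)" if "0 \<le> t"
    using flow_eq[OF sol that] by simp
qed

lemma compact_trapped: "compact (trapped m)"
proof -
  obtain L where L: "L-lipschitz_on (state_box m) (G p)" using G_lipschitz_on_state_box by blast
  have closed: "closed (state_box m)" unfolding state_box_def by (rule closed_cbox)
  have "closed (trapped m)"
    unfolding closed_sequential_limits
  proof (intro allI impI, elim conjE)
    fix xs x assume xs: "\<forall>n. xs n \<in> trapped m" "xs \<longlonglongrightarrow> x"
    have "flow 0 (xs n) = xs n" for n using flow_zero xs(1) by blast
    then have "(\<lambda>n. flow 0 (xs n)) \<longlonglongrightarrow> x" using xs(2) by simp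
    moreover have "((\<lambda>t. flow t (xs n)) has_vector_derivative G p (flow t (xs n))) (at t within {0..})"
      if "0 \<le> t" for n t using flow_derivative xs(1) that by blast
    moreover have "flow t (xs n) \<in> state_box m" if "0 \<le> t" for n t
      using flow_solution(2) xs(1) that by blast
    ultimately obtain u where u: "u 0 = x" "\<And>t. 0 \<le> t \<Longrightarrow> u t \<in> state_box m"
      "\<And>t. 0 \<le> t \<Longrightarrow> (u has_vector_derivative G p (u t)) (at t within {0..})"
      using solutions_limit[OF L closed, of "\<lambda>n t. flow t (xs n)" x] by blast
    then show "x \<in> trapped m"
      using state_box_subset_orthant[of m] by (auto simp: trapped_def fwd_solution_def intro!: exI[of _ u])
  qed
  moreover have "trapped m \<subseteq> state_box m"
    using flow_solution(2)[of _ m 0] flow_zero by fastforce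
  moreover have "compact (state_box m)" unfolding state_box_def by (rule compact_cbox)
  ultimately show ?thesis by (metis compact_Int_closed inf.absorb2)
qed

lemma flow_dist:
  obtains L where "\<And>x y t. x \<in> trapped m \<Longrightarrow> y \<in> trapped m \<Longrightarrow> 0 \<le> t \<Longrightarrow>
     dist (flow t x) (flow t y) \<le> exp (L * t) * dist x y"
proof -
  obtain L where L: "L-lipschitz_on (state_box m) (G p)" using G_lipschitz_on_state_box by blast
  have "dist (flow t x) (flow t y) \<le> exp (L * t) * dist x y"
    if "x \<in> trapped m" "y \<in> trapped m" "0 \<le> t" for x y t
  proof -
    have "dist (flow t x) (flow t y) \<le> exp (L * t) * dist (flow 0 x) (flow 0 y)"
      by (rule solutions_dist_bound[OF L that(3)]) (use flow_derivative flow_solution(2) that in blast)+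
    then show ?thesis using flow_zero that by simp
  qed
  then show ?thesis using that by blast
qed

lemma flow_strongly_monotone:
  assumes x: "x \<in> trapped m" and y: "y \<in> trapped m" and "sign_le order_signs x y" "x \<noteq> y" "0 < t" "i \<in> Basis"
  shows "(order_signs \<bullet> i) * (flow t x \<bullet> i) < (order_signs \<bullet> i) * (flow t y \<bullet> i)"
proof -
  obtain L where "cooperative_field order_signs (inverse (real (Suc m)) *\<^sub>R One) (real (Suc m) *\<^sub>R One) (G p) L"
    using cooperative_G by blast
  then interpret cooperative_field order_signs "inverse (real (Suc m)) *\<^sub>R One" "real (Suc m) *\<^sub>R One" "G p" L .
  show ?thesis
  proof (rule strong_comparison[of "\<lambda>t. flow t x" "\<lambda>t. flow t y"])
    show "\<exists>j\<in>Basis. a \<bullet> j = b \<bullet> j \<and> G p a \<bullet> j \<noteq> G p b \<bullet> j"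
      if "a \<in> cbox (inverse (real (Suc m)) *\<^sub>R One) (real (Suc m) *\<^sub>R One)"
        "b \<in> cbox (inverse (real (Suc m)) *\<^sub>R One) (real (Suc m) *\<^sub>R One)"
        "sign_le order_signs a b" "a \<noteq> b" "j \<in> Basis" "a \<bullet> j = b \<bullet> j" for a b j
      using G_irreducible[OF adm _ _ that(3-6)] that(1,2) state_box_subset_orthant[of m]
      unfolding state_box_def by blast
  qed (use assms flow_derivative[OF x] flow_derivative[OF y] flow_solution(2)[OF x] flow_solution(2)[OF y]
        flow_zero[OF x] flow_zero[OF y] in \<open>auto simp: state_box_def\<close>)
qed

lemma sop_semiflow_trapped: "sop_semiflow (trapped m) flow (sign_le order_signs)"
proof
  have signs: "order_signs \<bullet> i \<noteq> 0" if "i \<in> Basis" for i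
    using that by (auto simp: order_signs_def Basis_state)
  obtain L where L: "\<And>x y t. x \<in> trapped m \<Longrightarrow> y \<in> trapped m \<Longrightarrow> 0 \<le> t \<Longrightarrow>
     dist (flow t x) (flow t y) \<le> exp (L * t) * dist x y"
    using flow_dist by blast
  show "compact (trapped m)" by (rule compact_trapped)
  show "sign_le order_signs x x" for x by (simp add: sign_le_def)
  show "sign_le order_signs x z" if "sign_le order_signs x y" "sign_le order_signs y z" for x y z
    using that unfolding sign_le_def by (meson order_trans)
  show "x = y" if "sign_le order_signs x y" "sign_le order_signs y x" for x y
  proof (rule euclidean_eqI)
    fix i :: state assume i: "i \<in> Basis"
    then have "(order_signs \<bullet> i) * (x \<bullet> i) = (order_signs \<bullet> i) * (y \<bullet> i)"
      using that unfolding sign_le_def by (meson antisym)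
    then show "x \<bullet> i = y \<bullet> i" using signs[OF i] by simp
  qed
  show "sign_le order_signs x y" if "xs \<longlonglongrightarrow> x" "ys \<longlonglongrightarrow> y" "\<And>n. sign_le order_signs (xs n) (ys n)" for xs ys x y
    unfolding sign_le_def
  proof
    fix i :: state assume "i \<in> Basis"
    then show "(order_signs \<bullet> i) * (x \<bullet> i) \<le> (order_signs \<bullet> i) * (y \<bullet> i)"
      using that(3) unfolding sign_le_def
      by (intro LIMSEQ_le[of "\<lambda>n. (order_signs \<bullet> i) * (xs n \<bullet> i)" _ "\<lambda>n. (order_signs \<bullet> i) * (ys n \<bullet> i)"]
          tendsto_intros that) auto
  qed
  show "flow t x \<in> trapped m" if "x \<in> trapped m" "0 \<le> t" for x t using flow_semigroup(1) that by blast
  show "flow 0 x = x" if "x \<in> trapped m" for x using flow_zero that by blast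
  show "flow (s + t) x = flow s (flow t x)" if "x \<in> trapped m" "0 \<le> s" "0 \<le> t" for x s t
    using flow_semigroup(2) that by blast
  show "(\<lambda>n. flow (ts n) (xs n)) \<longlonglongrightarrow> flow t x"
    if "\<And>n. 0 \<le> ts n" "\<And>n. xs n \<in> trapped m" "x \<in> trapped m" "ts \<longlonglongrightarrow> t" "xs \<longlonglongrightarrow> x" for ts xs x t
  proof -
    have "0 \<le> t" using that(1,4) by (meson LIMSEQ_le_const)
    have "(\<lambda>n. exp (L * ts n) * dist (xs n) x) \<longlonglongrightarrow> exp (L * t) * dist x x"
      by (intro tendsto_intros that)
    then have up: "(\<lambda>n. exp (L * ts n) * dist (xs n) x) \<longlonglongrightarrow> 0" by simp
    have "(\<lambda>n. dist (flow (ts n) (xs n)) (flow (ts n) x)) \<longlonglongrightarrow> 0"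
    proof (rule tendsto_sandwich[OF _ _ tendsto_const up])
      show "\<forall>\<^sub>F n in sequentially. dist (flow (ts n) (xs n)) (flow (ts n) x) \<le> exp (L * ts n) * dist (xs n) x"
        using L[OF that(2,3,1)] by (rule always_eventually[OF allI])
    qed simp
    moreover have "(\<lambda>n. flow (ts n) x) \<longlonglongrightarrow> flow t x"
      using continuous_on_tendsto_compose[OF fwd_solution_continuous[OF flow_solution(1)[OF that(3)]] that(4)]
        \<open>0 \<le> t\<close> that(1) by simp
    ultimately show ?thesis
      using Lim_transform[of _ _ _ "\<lambda>n. flow (ts n) (xs n)"] by (simp add: dist_norm tendsto_norm_zero_iff)
  qed
  show "\<exists>e>0. \<forall>x'\<in>trapped m. \<forall>y'\<in>trapped m. dist x' x < e \<longrightarrow> dist y' y < e \<longrightarrow>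
          sign_le order_signs (flow t x') (flow t y')"
    if xy: "x \<in> trapped m" "y \<in> trapped m" "sign_le order_signs x y" "x \<noteq> y" "0 < t" for x y t
  proof -
    define gap where "gap = Min ((\<lambda>i. (order_signs \<bullet> i) * (flow t y \<bullet> i) - (order_signs \<bullet> i) * (flow t x \<bullet> i)) ` Basis)"
    have "0 < gap" unfolding gap_def
      using flow_strongly_monotone[OF xy] by (subst Min_gr_iff) auto
    have gap: "gap \<le> (order_signs \<bullet> i) * (flow t y \<bullet> i) - (order_signs \<bullet> i) * (flow t x \<bullet> i)" if "i \<in> Basis" for i
      unfolding gap_def using that by (intro Min_le) auto
    define e where "e = gap / (2 * exp (L * t))"
    have close: "\<bar>(order_signs \<bullet> i) * (flow t w' \<bullet> i) - (order_signs \<bullet> i) * (flow t w \<bullet> i)\<bar> \<le> gap / 2"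
      if "w \<in> trapped m" "w' \<in> trapped m" "dist w' w < e" "i \<in> Basis" for w w' i
    proof -
      have "\<bar>(order_signs \<bullet> i) * (flow t w' \<bullet> i) - (order_signs \<bullet> i) * (flow t w \<bullet> i)\<bar>
          = \<bar>(flow t w' - flow t w) \<bullet> i\<bar>"
        using \<open>i \<in> Basis\<close> unfolding Basis_state order_signs_def
        by (auto simp: inner_diff_left abs_minus_commute)
      also have "\<dots> \<le> dist (flow t w') (flow t w)"
        using Basis_le_norm[OF that(4)] by (simp add: dist_norm)
      also have "\<dots> \<le> exp (L * t) * dist w' w" using L that xy(5) by simp
      also have "\<dots> \<le> exp (L * t) * e" using that(3) by simp
      finally show ?thesis by (simp add: e_def)
    qed
    have "sign_le order_signs (flow t x') (flow t y')"
      if "x' \<in> trapped m" "y' \<in> trapped m" "dist x' x < e" "dist y' y < e" for x' y'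
      unfolding sign_le_def
    proof
      fix i :: state assume i: "i \<in> Basis"
      show "(order_signs \<bullet> i) * (flow t x' \<bullet> i) \<le> (order_signs \<bullet> i) * (flow t y' \<bullet> i)"
        using close[OF xy(1) that(1,3) i] close[OF xy(2) that(2,4) i] gap[OF i] by linarith
    qed
    moreover have "0 < e" using \<open>0 < gap\<close> by (simp add: e_def)
    ultimately show ?thesis by blast
  qed
qed

lemma fixed_point_equilibrium:
  assumes "e \<in> trapped m" "\<And>t. 0 \<le> t \<Longrightarrow> flow t e = e"
  shows "e \<in> equilibria p"
proof -
  have "((\<lambda>t. flow t e) has_vector_derivative G p e) (at 1 within {0..})"
    using flow_derivative[OF assms(1), of 1] assms(2) by simp
  then have "((\<lambda>t. e) has_vector_derivative G p e) (at 1 within {0..})"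
    by (rule has_vector_derivative_transform[rotated 2]) (use assms(2) in auto)
  moreover have "at 1 within {0::real..} = at 1" by (intro at_within_interior) simp
  ultimately have "((\<lambda>t::real. e) has_vector_derivative G p e) (at 1)" by simp
  then have "G p e = 0"
    using vector_derivative_unique_at[OF _ has_vector_derivative_const] by blast
  moreover have "e \<in> orthant"
    using flow_solution(2)[OF assms(1), of 0] flow_zero[OF assms(1)] state_box_subset_orthant by auto
  ultimately show ?thesis by (simp add: equilibria_def)
qed

definition cauchy_orbits :: "nat \<Rightarrow> state set" where
  "cauchy_orbits m = {x \<in> trapped m. \<forall>k::nat. \<exists>N::nat. \<forall>s\<ge>real N. \<forall>t\<ge>real N.
      dist (flow s x) (flow t x) \<le> inverse (real (Suc k))}"

lemma cauchy_orbits_borel: "cauchy_orbits m \<in> sets borel"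
proof -
  obtain L where L: "\<And>x y t. x \<in> trapped m \<Longrightarrow> y \<in> trapped m \<Longrightarrow> 0 \<le> t \<Longrightarrow>
     dist (flow t x) (flow t y) \<le> exp (L * t) * dist x y"
    using flow_dist by blast
  have closed: "closed (trapped m)" using compact_trapped compact_imp_closed by blast
  have cont: "continuous_on (trapped m) (flow t)" if "0 \<le> t" for t
    by (rule lipschitz_on_continuous_on[of "exp (L * t)"]) (use L that in \<open>auto intro!: lipschitz_onI\<close>)
  have "closed (\<Inter>s\<in>{real N..}. \<Inter>t\<in>{real N..}. {x \<in> trapped m. dist (flow s x) (flow t x) \<le> c})" for N c
  proof (intro closed_INT ballI)
    fix s t assume st: "s \<in> {real N..}" "t \<in> {real N..}"
    have "{x \<in> trapped m. dist (flow s x) (flow t x) \<le> c}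
        = trapped m \<inter> (\<lambda>x. dist (flow s x) (flow t x)) -` {..c}" by auto
    also have "closed \<dots>"
      using st by (intro continuous_closed_preimage[OF _ closed] continuous_on_dist cont)
        (auto intro: order_trans[of 0 "real N"])
    finally show "closed {x \<in> trapped m. dist (flow s x) (flow t x) \<le> c}" .
  qed
  then have "(\<Inter>k::nat. \<Union>N::nat. \<Inter>s\<in>{real N..}. \<Inter>t\<in>{real N..}.
      {x \<in> trapped m. dist (flow s x) (flow t x) \<le> inverse (real (Suc k))}) \<in> sets borel"
    by (intro sets.countable_INT'' sets.countable_UN) auto
  then have "trapped m \<inter> (\<Inter>k::nat. \<Union>N::nat. \<Inter>s\<in>{real N..}. \<Inter>t\<in>{real N..}.
      {x \<in> trapped m. dist (flow s x) (flow t x) \<le> inverse (real (Suc k))}) \<in> sets borel"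
    using closed by (intro sets.Int) auto
  moreover have "cauchy_orbits m = trapped m \<inter> (\<Inter>k::nat. \<Union>N::nat. \<Inter>s\<in>{real N..}. \<Inter>t\<in>{real N..}.
      {x \<in> trapped m. dist (flow s x) (flow t x) \<le> inverse (real (Suc k))})"
    unfolding cauchy_orbits_def
    by (rule set_eqI) (simp only: mem_Collect_eq Int_iff INT_iff UN_iff atLeast_iff Ball_def UNIV_I simp_thms, blast)
  ultimately show ?thesis by simp
qed

lemma cauchy_orbit_converges:
  assumes "x \<in> cauchy_orbits m"
  obtains e where "e \<in> equilibria p" "((\<lambda>t. flow t x) \<longlongrightarrow> e) at_top"
proof -
  interpret sop_semiflow "trapped m" flow "sign_le order_signs" by (rule sop_semiflow_trapped)
  have x: "x \<in> trapped m" using assms by (simp add: cauchy_orbits_def)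
  have uniq: "a = b" if ab: "a \<in> \<omega> x" "b \<in> \<omega> x" for a b
  proof (rule ccontr)
    assume "a \<noteq> b"
    then obtain k where k: "inverse (real (Suc k)) < dist a b / 3"
      using reals_Archimedean[of "dist a b / 3"] by auto
    obtain N :: nat where N: "\<And>s t. s \<ge> real N \<Longrightarrow> t \<ge> real N \<Longrightarrow> dist (flow s x) (flow t x) \<le> inverse (real (Suc k))"
      using assms unfolding cauchy_orbits_def by blast
    have d: "0 < dist a b / 3" using \<open>a \<noteq> b\<close> by simp
    obtain s where s: "s \<ge> real N" "dist (flow s x) a < dist a b / 3"
      using ab(1) d unfolding omega_limit_iff by blast
    obtain t where t: "t \<ge> real N" "dist (flow t x) b < dist a b / 3"
      using ab(2) d unfolding omega_limit_iff by blast
    have "dist a b \<le> dist a (flow s x) + dist (flow s x) (flow t x) + dist (flow t x) b"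
      using dist_triangle[of a b "flow s x"] dist_triangle[of "flow s x" b "flow t x"] by linarith
    then show False using s(2) t(2) N[OF s(1) t(1)] k by (simp add: dist_commute)
  qed
  obtain e where e: "e \<in> \<omega> x" using omega_nonempty[OF x] by blast
  have "flow t e = e" if "0 \<le> t" for t using uniq[OF omega_flow[OF x e that] e] .
  then have "e \<in> equilibria p" using fixed_point_equilibrium omega_sub[OF x] e by blast
  moreover have "((\<lambda>t. flow t x) \<longlongrightarrow> e) at_top"
    using tendsto_if_omega_subset_singleton[OF x] uniq e by blast
  ultimately show ?thesis using that by blast
qed

context
  assumes td: "totally_disconnected (equilibria p)"
begin

lemma non_cauchy_orbit_limit_moves:
  assumes x: "x \<in> trapped m" and nc: "x \<notin> cauchy_orbits m"
  obtains a t where "a \<in> omega_limit flow x" "0 \<le> t" "flow t a \<noteq> a"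
proof -
  interpret sop_semiflow "trapped m" flow "sign_le order_signs" by (rule sop_semiflow_trapped)
  have "\<exists>a\<in>\<omega> x. \<exists>t\<ge>0. flow t a \<noteq> a"
  proof (rule ccontr)
    assume "\<not> ?thesis"
    then have "\<omega> x \<subseteq> equilibria p" using fixed_point_equilibrium omega_sub[OF x] by blast
    then obtain e where "\<omega> x \<subseteq> {e}" using td connected_omega[OF x] unfolding totally_disconnected_def by blast
    then have lim: "((\<lambda>t. flow t x) \<longlongrightarrow> e) at_top" by (rule tendsto_if_omega_subset_singleton[OF x])
    have "\<exists>N::nat. \<forall>s\<ge>real N. \<forall>t\<ge>real N. dist (flow s x) (flow t x) \<le> inverse (real (Suc k))" for k
    proof -
      have "\<forall>\<^sub>F t in at_top. dist (flow t x) e < inverse (real (Suc k)) / 2"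
        using lim by (rule tendstoD) simp
      then obtain T where T: "\<And>t. t \<ge> T \<Longrightarrow> dist (flow t x) e < inverse (real (Suc k)) / 2"
        unfolding eventually_at_top_linorder by blast
      have "dist (flow s x) (flow t x) \<le> inverse (real (Suc k))"
        if "s \<ge> real (nat \<lceil>T\<rceil>)" "t \<ge> real (nat \<lceil>T\<rceil>)" for s t
      proof -
        have "s \<ge> T" "t \<ge> T" using that by linarith+
        then show ?thesis using T[of s] T[of t] dist_triangle2[of "flow s x" "flow t x" e] by linarith
      qed
      then show ?thesis by blast
    qed
    then have "x \<in> cauchy_orbits m" using x by (simp add: cauchy_orbits_def)
    then show False using nc by blast
  qed
  then show ?thesis using that by blast
qed

lemma countable_non_cauchy_slice: "countable {a. (a, r) \<in> trapped m - cauchy_orbits m}"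
proof -
  interpret sop_semiflow "trapped m" flow "sign_le order_signs" by (rule sop_semiflow_trapped)
  define J where "J = {a. (a, r) \<in> trapped m - cauchy_orbits m}"
  have "\<exists>i q. i \<in> Basis \<and> q \<in> \<rat> \<and> (\<exists>b\<in>\<omega> (a, r). b \<bullet> i < q) \<and> (\<exists>b\<in>\<omega> (a, r). q < b \<bullet> i)" if "a \<in> J" for a
  proof -
    have a: "(a, r) \<in> trapped m" "(a, r) \<notin> cauchy_orbits m" using that by (auto simp: J_def)
    obtain b t where b: "b \<in> \<omega> (a, r)" "0 \<le> t" "flow t b \<noteq> b"
      using non_cauchy_orbit_limit_moves[OF a] by blast
    then obtain i where i: "i \<in> Basis" "flow t b \<bullet> i \<noteq> b \<bullet> i" using euclidean_eqI by blast
    have tb: "flow t b \<in> \<omega> (a, r)" using omega_flow[OF a(1) b(1,2)] .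
    consider "flow t b \<bullet> i < b \<bullet> i" | "b \<bullet> i < flow t b \<bullet> i" using i(2) by linarith
    then show ?thesis
    proof cases
      case 1
      then show ?thesis using Rats_dense_in_real[OF 1] i(1) b(1) tb by blast
    next
      case 2
      then show ?thesis using Rats_dense_in_real[OF 2] i(1) b(1) tb by blast
    qed
  qed
  then obtain f g where fg: "\<And>a. a \<in> J \<Longrightarrow> f a \<in> Basis" "\<And>a. a \<in> J \<Longrightarrow> g a \<in> \<rat>"
    "\<And>a. a \<in> J \<Longrightarrow> \<exists>b\<in>\<omega> (a, r). b \<bullet> f a < g a" "\<And>a. a \<in> J \<Longrightarrow> \<exists>b\<in>\<omega> (a, r). g a < b \<bullet> f a"
    by metis
  have ne: "\<not> (f a = f a' \<and> g a = g a')" if aa: "a \<in> J" "a' \<in> J" "a < a'" for a a'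
  proof
    assume eq: "f a = f a' \<and> g a = g a'"
    have tr: "(a, r) \<in> trapped m" "(a', r) \<in> trapped m" "(a', r) \<notin> cauchy_orbits m"
      using aa by (auto simp: J_def)
    obtain b t where b: "b \<in> \<omega> (a', r)" "0 \<le> t" "flow t b \<noteq> b"
      using non_cauchy_orbit_limit_moves[OF tr(2,3)] by blast
    have "sign_le order_signs (a', r) (a, r)"
      using aa(3) by (cases r) (simp add: sign_le_order_signs)
    then have ord: "sign_le order_signs c e" if "c \<in> \<omega> (a', r)" "e \<in> \<omega> (a, r)" for c e
      using omega_ordered[OF tr(2,1) _ _ b that] aa(3) by simp
    define i where "i = f a"
    have i: "i \<in> Basis" using fg(1) aa by (simp add: i_def)
    obtain l u where lu: "l \<in> \<omega> (a, r)" "u \<in> \<omega> (a, r)" "l \<bullet> i < g a" "g a < u \<bullet> i"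
      using fg(3,4)[OF aa(1)] by (auto simp: i_def)
    obtain l' u' where lu': "l' \<in> \<omega> (a', r)" "u' \<in> \<omega> (a', r)" "l' \<bullet> i < g a" "g a < u' \<bullet> i"
      using fg(3,4)[OF aa(2)] eq by (auto simp: i_def)
    have "order_signs \<bullet> i = 1 \<or> order_signs \<bullet> i = - 1"
      using i by (auto simp: order_signs_def Basis_state)
    then show False
      using ord[OF lu'(2) lu(1)] ord[OF lu'(1) lu(2)] lu lu' i unfolding sign_le_def by force
  qed
  have "inj_on (\<lambda>a. (f a, g a)) J"
    by (rule linorder_inj_onI') (use ne in auto)
  moreover have "countable ((\<lambda>a. (f a, g a)) ` J)"
    by (rule countable_subset[of _ "Basis \<times> \<rat>"])
       (use fg in \<open>auto simp: countable_finite countable_rat intro!: countable_SIGMA\<close>)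
  ultimately show ?thesis using countable_image_inj_on unfolding J_def by blast
qed

lemma null_non_cauchy: "trapped m - cauchy_orbits m \<in> null_sets lborel"
proof -
  have B: "trapped m - cauchy_orbits m \<in> sets (lborel :: state measure)"
    using sets.Diff[OF borel_compact[OF compact_trapped] cauchy_orbits_borel] by simp
  have "emeasure (lborel \<Otimes>\<^sub>M lborel) (trapped m - cauchy_orbits m)
      = (\<integral>\<^sup>+ r. emeasure lborel ((\<lambda>a. (a, r)) -` (trapped m - cauchy_orbits m)) \<partial>lborel)"
    by (rule lborel_pair.emeasure_pair_measure_alt2) (simp only: lborel_prod B)
  also have "\<dots> = 0"
  proof -
    have "emeasure lborel ((\<lambda>a. (a, r)) -` (trapped m - cauchy_orbits m)) = 0" for r
      using countable_non_cauchy_slice[of r m] by (intro emeasure_lborel_countable) (simp add: vimage_def)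
    then show ?thesis by simp
  qed
  finally show ?thesis using B unfolding lborel_prod by (rule null_setsI)
qed

end

end

theorem theorem4:
  fixes p :: params
  assumes "admissible p"
    and "totally_disconnected (equilibria p)"
  shows "AE x0 in lebesgue. x0 \<in> Wc p \<longrightarrow>
           (\<forall>x. fwd_solution p x0 x \<longrightarrow> (\<exists>e\<in>equilibria p. (x \<longlongrightarrow> e) at_top))"
proof -
  define B where "B = (\<Union>m. trapped p m - cauchy_orbits p m)"
  have "B \<in> null_sets lborel"
    unfolding B_def using null_non_cauchy[OF assms] by (intro null_sets_UN) auto
  then have "AE x0 in lebesgue. x0 \<notin> B"
    by (intro AE_completion AE_not_in)
  then show ?thesis
  proof (rule AE_mp, intro AE_I2 impI allI)
    fix x0 x assume x0: "x0 \<notin> B" "x0 \<in> Wc p" and x: "fwd_solution p x0 x"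
    obtain m where "x0 \<in> trapped p m" using Wc_subset_trapped[OF assms(1)] x0(2) by blast
    then have "x0 \<in> cauchy_orbits p m" using x0(1) by (auto simp: B_def)
    then obtain e where e: "e \<in> equilibria p" "((\<lambda>t. flow p t x0) \<longlongrightarrow> e) at_top"
      using cauchy_orbit_converges[OF assms(1)] by blast
    have "\<forall>\<^sub>F t in at_top. flow p t x0 = x t"
      using eventually_ge_at_top[of 0] by eventually_elim (rule flow_eq[OF assms(1) x])
    then have "(x \<longlongrightarrow> e) at_top" by (rule Lim_transform_eventually[OF e(2)])
    then show "\<exists>e\<in>equilibria p. (x \<longlongrightarrow> e) at_top" using e(1) by blast
  qed
qed

end
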